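(* Let $\{g(t,s)\}$ be the smooth $2$-parameter family of Riemannian metrics on a smooth $n$-manifold $M$ described in the context (a Ricci flow $g(t)=g(t,0)$ varied in $s$ through solutions of the modified Ricci flow with DeTurck term $W$, with variation $h(t)=\frac{\partial}{\partial s}g(t,0)$). For $N$ sufficiently large, let $\widehat g=\widehat g(s,N)$ be the metric on $\tilde M=M\times[0,T)$ given by $$\widehat g_{ij}=g_{ij}\ \ (i,j\ge1),\qquad \widehat g_{i0}=\widehat g_{0i}=W_i+\tfrac12\nabla_i\log\frac{\det g(t,s)}{\det g(t,0)}\ \ (i\ge1),$$ $$\widehat g_{00}=R+|W|^2+\frac{\partial}{\partial t}\log\frac{\det g(t,s)}{\det g(t,0)}+N,$$ where $g=g(t,s)$ and $R$, $\nabla$, $|\cdot|$ are taken with respect to $g(t,s)$. Then for all $0\le i,j\le n$, at $s=0$, $$\frac{\partial}{\partial s}\widehat g_{ij}=\tilde h_{ij}.$$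
   Context: Setting. $g(t)$, $t\in[0,T)$, is a solution of the Ricci flow $\frac{\partial}{\partial t}g_{ij}=-2R_{ij}$ on $M$ with $g(0)=g_0$, and $h(t)$ is a symmetric $2$-tensor solving $\frac{\partial}{\partial t}h_{ij}=\Delta h_{ij}+2R_{pijq}h_{pq}-R_{iq}h_{jq}-R_{jq}h_{iq}$ with $h(0)=h_0$. The smooth $2$-parameter family of metrics $g(t,s)$, $t\in[0,T)$, $s$ near $0$, satisfies $$\frac{\partial}{\partial t}g_{ij}(t,s)=(-2R_{ij}+\nabla_iW_j+\nabla_jW_i)(t,s),\qquad W^k(t,s)=g^{ij}(t,s)\left(\Gamma_{ij}^k(t,s)-\Gamma_{ij}^k(t,0)\right),$$ with $g(0,0)=g_0$ and $\frac{\partial}{\partial s}g(0,0)=h_0$, where curvature, $\nabla$ and $\Gamma^k_{ij}(t,s)$ on the right are those of $g(t,s)$ and $W_j=g_{jk}W^k$. Moreover $g(t,0)=g(t)$ and $\frac{\partial}{\partial s}g_{ij}(t,0)=h_{ij}(t)$ for all $t\in[0,T)$. Curvature conventions: $R^l_{ijk}=\partial_i\Gamma^l_{jk}-\partial_j\Gamma^l_{ik}+\Gamma^p_{jk}\Gamma^l_{ip}-\Gamma^p_{ik}\Gamma^l_{jp}$, $R_{ijkl}=g_{lm}R^m_{ijk}$, $R_{jk}=R^p_{pjk}$; repeated lower indices are contracted with $g^{-1}$. Coordinates on $\tilde M$ are $(x^0=t,x^1,\dots,x^n)$ with $x^1,\dots,x^n$ local coordinates on $M$; the quotient $\det g(t,s)/\det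 g(t,0)$ is computed in such coordinates and is independent of the choice. The space-time extension of $h$ (formed with $g(t)=g(t,0)$) is the symmetric $2$-tensor on $\tilde M$ with $\tilde h_{ij}=h_{ij}$ if $i,j\ge1$; $\tilde h_{0j}=\tilde h_{j0}=\mathrm{div}(h)_j=g^{pq}\nabla_ph_{qj}$ if $j\ge1$; $\tilde h_{00}=\mathrm{div}(\mathrm{div}(h))+Rc\cdot h$, where $\mathrm{div}(\mathrm{div}(h))=g^{jk}\nabla_j\mathrm{div}(h)_k$ and $Rc\cdot h=g^{ip}g^{jq}R_{ij}h_{pq}$. *)

theory Defs
  imports "HOL-Analysis.Analysis"
begin

section \<open>Smooth functions\<close>

primrec Ck_on :: "nat \<Rightarrow> 'a::euclidean_space set \<Rightarrow> ('a \<Rightarrow> 'b::real_normed_vector) \<Rightarrow> bool" where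
  "Ck_on 0 U f \<longleftrightarrow> continuous_on U f"
| "Ck_on (Suc k) U f \<longleftrightarrow>
     (\<forall>x\<in>U. f differentiable (at x)) \<and>
     (\<forall>b\<in>Basis. Ck_on k U (\<lambda>x. frechet_derivative f (at x) b))"

text \<open>Smoothness on an arbitrary set is local extendability to a smooth function on an open set.
  For open \<open>S\<close> this is the usual notion; for products with \<open>[0,T)\<close> it is smoothness up to the
  boundary \<open>t = 0\<close>.\<close>

definition smooth_on :: "'a::euclidean_space set \<Rightarrow> ('a \<Rightarrow> 'b::real_normed_vector) \<Rightarrow> bool" where
  "smooth_on S f \<longleftrightarrow>
     (\<forall>p\<in>S. \<exists>V F. open V \<and> p \<in> V \<and> (\<forall>k. Ck_on k V F) \<and> (\<forall>x\<in>S \<inter> V. F x = f x))"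

definition pd :: "'n::finite \<Rightarrow> (real^'n \<Rightarrow> real) \<Rightarrow> real^'n \<Rightarrow> real" where
  "pd i f x = deriv (\<lambda>r. f (x + r *\<^sub>R axis i 1)) 0"


section \<open>Smooth manifolds and tensors\<close>

text \<open>A chart is a pair of a domain and a coordinate map; the values of the coordinate map outside
  the domain are irrelevant. The manifold is the whole type, with charts in \<open>real^'n\<close>, so the
  dimension is \<open>CARD('n)\<close>.\<close>

type_synonym ('m, 'n) chart = "'m set \<times> ('m \<Rightarrow> real^'n)"

definition coords :: "('m, 'n::finite) chart \<Rightarrow> (real^'n) set" where
  "coords c = snd c ` fst c"

definition transition :: "('m, 'n::finite) chart \<Rightarrow> ('m, 'n) chart \<Rightarrow> real^'n \<Rightarrow> real^'n" where
  "transition c d x = snd d (inv_into (fst c) (snd c) x)"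

definition smooth_atlas ::
  "('m::{t2_space, second_countable_topology}, 'n::finite) chart set \<Rightarrow> bool" where
  "smooth_atlas A \<longleftrightarrow>
     (\<Union>c\<in>A. fst c) = UNIV \<and>
     (\<forall>c\<in>A. open (fst c) \<and> open (coords c) \<and>
        (\<exists>\<psi>. homeomorphism (fst c) (coords c) (snd c) \<psi>)) \<and>
     (\<forall>c\<in>A. \<forall>d\<in>A. smooth_on (snd c ` (fst c \<inter> fst d)) (transition c d))"

text \<open>A covariant 2-tensor field is the family of its component matrices in the charts, as
  functions of the coordinates, subject to the transformation law.\<close>

type_synonym ('m, 'n) tensor2 = "('m, 'n) chart \<Rightarrow> real^'n \<Rightarrow> real^'n^'n"

definition tensor2_field :: "('m, 'n::finite) chart set \<Rightarrow> ('m, 'n) tensor2 \<Rightarrow> bool" where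
  "tensor2_field A b \<longleftrightarrow>
     (\<forall>c\<in>A. \<forall>d\<in>A. \<forall>x\<in>snd c ` (fst c \<inter> fst d). \<forall>i j.
        b c x $ i $ j =
          (\<Sum>k\<in>UNIV. \<Sum>l\<in>UNIV. pd i (\<lambda>y. transition c d y $ k) x
             * pd j (\<lambda>y. transition c d y $ l) x * b d (transition c d x) $ k $ l))"

definition symmetric_tensor2 :: "('m, 'n::finite) chart set \<Rightarrow> ('m, 'n) tensor2 \<Rightarrow> bool" where
  "symmetric_tensor2 A b \<longleftrightarrow>
     tensor2_field A b \<and>
     (\<forall>c\<in>A. smooth_on (coords c) (b c) \<and> (\<forall>x\<in>coords c. transpose (b c x) = b c x))"

definition positive_definite :: "real^'k::finite^'k \<Rightarrow> bool" where
  "positive_definite B \<longleftrightarrow> transpose B = B \<and> (\<forall>v. v \<noteq> 0 \<longrightarrow> v \<bullet> (B *v v) > 0)"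

definition riemannian_metric :: "('m, 'n::finite) chart set \<Rightarrow> ('m, 'n) tensor2 \<Rightarrow> bool" where
  "riemannian_metric A b \<longleftrightarrow>
     symmetric_tensor2 A b \<and> (\<forall>c\<in>A. \<forall>x\<in>coords c. positive_definite (b c x))"

definition same_tensor2 ::
  "('m, 'n::finite) chart set \<Rightarrow> ('m, 'n) tensor2 \<Rightarrow> ('m, 'n) tensor2 \<Rightarrow> bool" where
  "same_tensor2 A a b \<longleftrightarrow> (\<forall>c\<in>A. \<forall>x\<in>coords c. a c x = b c x)"


section \<open>Riemannian geometry in local coordinates\<close>

text \<open>Throughout, \<open>m\<close> is the component matrix of a metric in a chart. Indices precede the
  coordinate argument, and a 2-tensor is given by its component matrix.\<close>

definition ginv :: "(real^'n \<Rightarrow> real^'n^'n) \<Rightarrow> 'n::finite \<Rightarrow> 'n \<Rightarrow> real^'n \<Rightarrow> real" where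
  "ginv m i j x = matrix_inv (m x) $ i $ j"

text \<open>\<open>christoffel m k i j\<close> is \<open>\<Gamma>\<^sup>k\<^sub>i\<^sub>j\<close>, and \<open>riem m l i j k\<close> is \<open>R\<^sup>l\<^sub>i\<^sub>j\<^sub>k\<close>: the upper index
  comes first.\<close>

definition christoffel ::
  "(real^'n \<Rightarrow> real^'n^'n) \<Rightarrow> 'n::finite \<Rightarrow> 'n \<Rightarrow> 'n \<Rightarrow> real^'n \<Rightarrow> real" where
  "christoffel m k i j x =
     (\<Sum>l\<in>UNIV. ginv m k l x *
        (pd i (\<lambda>y. m y $ j $ l) x + pd j (\<lambda>y. m y $ i $ l) x - pd l (\<lambda>y. m y $ i $ j) x)) / 2"

definition riem ::
  "(real^'n \<Rightarrow> real^'n^'n) \<Rightarrow> 'n::finite \<Rightarrow> 'n \<Rightarrow> 'n \<Rightarrow> 'n \<Rightarrow> real^'n \<Rightarrow> real" where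
  "riem m l i j k x =
     pd i (christoffel m l j k) x - pd j (christoffel m l i k) x
     + (\<Sum>p\<in>UNIV. christoffel m p j k x * christoffel m l i p x
                 - christoffel m p i k x * christoffel m l j p x)"

definition riem_low ::
  "(real^'n \<Rightarrow> real^'n^'n) \<Rightarrow> 'n::finite \<Rightarrow> 'n \<Rightarrow> 'n \<Rightarrow> 'n \<Rightarrow> real^'n \<Rightarrow> real" where
  "riem_low m i j k l x = (\<Sum>q\<in>UNIV. m x $ l $ q * riem m q i j k x)"

definition ric :: "(real^'n \<Rightarrow> real^'n^'n) \<Rightarrow> 'n::finite \<Rightarrow> 'n \<Rightarrow> real^'n \<Rightarrow> real" where
  "ric m j k x = (\<Sum>p\<in>UNIV. riem m p p j k x)"

definition scal :: "(real^'n \<Rightarrow> real^'n^'n) \<Rightarrow> real^'n::finite \<Rightarrow> real" where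
  "scal m x = (\<Sum>j\<in>UNIV. \<Sum>k\<in>UNIV. ginv m j k x * ric m j k x)"

text \<open>Covariant derivatives of covariant tensors of rank 1, 2 and 3; the index of differentiation
  comes first.\<close>

definition cov1 ::
  "(real^'n \<Rightarrow> real^'n^'n) \<Rightarrow> ('n \<Rightarrow> real^'n \<Rightarrow> real)
     \<Rightarrow> 'n::finite \<Rightarrow> 'n \<Rightarrow> real^'n \<Rightarrow> real" where
  "cov1 m w i j x = pd i (w j) x - (\<Sum>k\<in>UNIV. christoffel m k i j x * w k x)"

definition cov2 ::
  "(real^'n \<Rightarrow> real^'n^'n) \<Rightarrow> (real^'n \<Rightarrow> real^'n^'n)
     \<Rightarrow> 'n::finite \<Rightarrow> 'n \<Rightarrow> 'n \<Rightarrow> real^'n \<Rightarrow> real" where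
  "cov2 m b p i j x =
     pd p (\<lambda>y. b y $ i $ j) x
     - (\<Sum>r\<in>UNIV. christoffel m r p i x * b x $ r $ j + christoffel m r p j x * b x $ i $ r)"

definition cov3 ::
  "(real^'n \<Rightarrow> real^'n^'n) \<Rightarrow> ('n \<Rightarrow> 'n \<Rightarrow> 'n \<Rightarrow> real^'n \<Rightarrow> real)
     \<Rightarrow> 'n::finite \<Rightarrow> 'n \<Rightarrow> 'n \<Rightarrow> 'n \<Rightarrow> real^'n \<Rightarrow> real" where
  "cov3 m S p q i j x =
     pd p (S q i j) x
     - (\<Sum>r\<in>UNIV. christoffel m r p q x * S r i j x
                 + christoffel m r p i x * S q r j x
                 + christoffel m r p j x * S q i r x)"

definition laplacian2 ::
  "(real^'n \<Rightarrow> real^'n^'n) \<Rightarrow> (real^'n \<Rightarrow> real^'n^'n)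
     \<Rightarrow> 'n::finite \<Rightarrow> 'n \<Rightarrow> real^'n \<Rightarrow> real" where
  "laplacian2 m b i j x =
     (\<Sum>p\<in>UNIV. \<Sum>q\<in>UNIV. ginv m p q x * cov3 m (cov2 m b) p q i j x)"

definition div2 ::
  "(real^'n \<Rightarrow> real^'n^'n) \<Rightarrow> (real^'n \<Rightarrow> real^'n^'n) \<Rightarrow> 'n::finite \<Rightarrow> real^'n \<Rightarrow> real" where
  "div2 m b j x = (\<Sum>p\<in>UNIV. \<Sum>q\<in>UNIV. ginv m p q x * cov2 m b p q j x)"

definition divdiv ::
  "(real^'n \<Rightarrow> real^'n^'n) \<Rightarrow> (real^'n \<Rightarrow> real^'n^'n) \<Rightarrow> real^'n::finite \<Rightarrow> real" where
  "divdiv m b x = (\<Sum>j\<in>UNIV. \<Sum>k\<in>UNIV. ginv m j k x * cov1 m (div2 m b) j k x)"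

definition ric_dot ::
  "(real^'n \<Rightarrow> real^'n^'n) \<Rightarrow> (real^'n \<Rightarrow> real^'n^'n) \<Rightarrow> real^'n::finite \<Rightarrow> real" where
  "ric_dot m b x =
     (\<Sum>i\<in>UNIV. \<Sum>j\<in>UNIV. \<Sum>p\<in>UNIV. \<Sum>q\<in>UNIV.
        ginv m i p x * ginv m j q x * ric m i j x * b x $ p $ q)"

text \<open>The DeTurck vector field of \<open>m\<close> with background metric \<open>m0\<close>, and its metric dual.\<close>

definition W_up ::
  "(real^'n \<Rightarrow> real^'n^'n) \<Rightarrow> (real^'n \<Rightarrow> real^'n^'n) \<Rightarrow> 'n::finite \<Rightarrow> real^'n \<Rightarrow> real" where
  "W_up m m0 k x =
     (\<Sum>i\<in>UNIV. \<Sum>j\<in>UNIV. ginv m i j x * (christoffel m k i j x - christoffel m0 k i j x))"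

definition W_low ::
  "(real^'n \<Rightarrow> real^'n^'n) \<Rightarrow> (real^'n \<Rightarrow> real^'n^'n) \<Rightarrow> 'n::finite \<Rightarrow> real^'n \<Rightarrow> real" where
  "W_low m m0 j x = (\<Sum>k\<in>UNIV. m x $ j $ k * W_up m m0 k x)"

definition W_norm2 ::
  "(real^'n \<Rightarrow> real^'n^'n) \<Rightarrow> (real^'n \<Rightarrow> real^'n^'n) \<Rightarrow> real^'n::finite \<Rightarrow> real" where
  "W_norm2 m m0 x = (\<Sum>i\<in>UNIV. \<Sum>j\<in>UNIV. m x $ i $ j * W_up m m0 i x * W_up m m0 j x)"

definition log_det_ratio ::
  "(real^'n \<Rightarrow> real^'n^'n) \<Rightarrow> (real^'n \<Rightarrow> real^'n^'n) \<Rightarrow> real^'n::finite \<Rightarrow> real" where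
  "log_det_ratio m m0 x = ln (det (m x) / det (m0 x))"


section \<open>The flows\<close>

text \<open>\<open>T\<close> may be infinite. Time derivatives are taken within \<open>[0,T)\<close>, hence are one-sided at 0.\<close>

definition time_interval :: "ereal \<Rightarrow> real set" where
  "time_interval T = {t. 0 \<le> t \<and> ereal t < T}"

definition ricci_flow ::
  "('m, 'n::finite) chart set \<Rightarrow> ereal \<Rightarrow> (real \<Rightarrow> ('m, 'n) tensor2) \<Rightarrow> bool" where
  "ricci_flow A T \<gamma> \<longleftrightarrow>
     (\<forall>t\<in>time_interval T. riemannian_metric A (\<gamma> t)) \<and>
     (\<forall>c\<in>A. smooth_on (time_interval T \<times> coords c) (\<lambda>(t, x). \<gamma> t c x)) \<and>
     (\<forall>c\<in>A. \<forall>t\<in>time_interval T. \<forall>x\<in>coords c. \<forall>i j.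
        ((\<lambda>\<tau>. \<gamma> \<tau> c x $ i $ j) has_real_derivative - 2 * ric (\<gamma> t c) i j x)
          (at t within time_interval T))"

definition lichnerowicz_heat_flow ::
  "('m, 'n::finite) chart set \<Rightarrow> ereal \<Rightarrow> (real \<Rightarrow> ('m, 'n) tensor2)
     \<Rightarrow> (real \<Rightarrow> ('m, 'n) tensor2) \<Rightarrow> bool" where
  "lichnerowicz_heat_flow A T \<gamma> h \<longleftrightarrow>
     (\<forall>t\<in>time_interval T. symmetric_tensor2 A (h t)) \<and>
     (\<forall>c\<in>A. smooth_on (time_interval T \<times> coords c) (\<lambda>(t, x). h t c x)) \<and>
     (\<forall>c\<in>A. \<forall>t\<in>time_interval T. \<forall>x\<in>coords c. \<forall>i j.
        ((\<lambda>\<tau>. h \<tau> c x $ i $ j) has_real_derivative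
           laplacian2 (\<gamma> t c) (h t c) i j x
           + 2 * (\<Sum>p\<in>UNIV. \<Sum>q\<in>UNIV. \<Sum>a\<in>UNIV. \<Sum>b\<in>UNIV.
                    ginv (\<gamma> t c) p a x * ginv (\<gamma> t c) q b x
                    * riem_low (\<gamma> t c) p i j q x * h t c x $ a $ b)
           - (\<Sum>q\<in>UNIV. \<Sum>a\<in>UNIV. ginv (\<gamma> t c) q a x * ric (\<gamma> t c) i q x * h t c x $ j $ a)
           - (\<Sum>q\<in>UNIV. \<Sum>a\<in>UNIV. ginv (\<gamma> t c) q a x * ric (\<gamma> t c) j q x * h t c x $ i $ a))
          (at t within time_interval T))"

text \<open>The 2-parameter family \<open>g t s\<close>, \<open>0 \<le> t < T\<close>, \<open>\<bar>s\<bar> < \<sigma>\<close>, solving the modified Ricci flow in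
  \<open>t\<close> for each \<open>s\<close>, with background metric \<open>g t 0\<close>.\<close>

definition modified_ricci_flow_family ::
  "('m, 'n::finite) chart set \<Rightarrow> ereal \<Rightarrow> real \<Rightarrow> (real \<Rightarrow> real \<Rightarrow> ('m, 'n) tensor2) \<Rightarrow> bool" where
  "modified_ricci_flow_family A T \<sigma> g \<longleftrightarrow>
     (\<forall>t\<in>time_interval T. \<forall>s\<in>{-\<sigma><..<\<sigma>}. riemannian_metric A (g t s)) \<and>
     (\<forall>c\<in>A. smooth_on (time_interval T \<times> {-\<sigma><..<\<sigma>} \<times> coords c) (\<lambda>(t, s, x). g t s c x)) \<and>
     (\<forall>c\<in>A. \<forall>t\<in>time_interval T. \<forall>s\<in>{-\<sigma><..<\<sigma>}. \<forall>x\<in>coords c. \<forall>i j.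
        ((\<lambda>\<tau>. g \<tau> s c x $ i $ j) has_real_derivative
           - 2 * ric (g t s c) i j x
           + cov1 (g t s c) (W_low (g t s c) (g t 0 c)) i j x
           + cov1 (g t s c) (W_low (g t s c) (g t 0 c)) j i x)
          (at t within time_interval T))"


section \<open>Space-time tensors\<close>

text \<open>Space-time indices have type \<open>'n option\<close>: \<open>None\<close> is the time index 0 and \<open>Some i\<close> is a
  spatial index. Space-time tensors are given by their components in the coordinates \<open>(t, x)\<close> of
  \<open>M \<times> [0,T)\<close>, with \<open>x\<close> the coordinates of the chart \<open>c\<close>.\<close>

definition g_hat ::
  "ereal \<Rightarrow> (real \<Rightarrow> real \<Rightarrow> ('m, 'n::finite) tensor2) \<Rightarrow> real \<Rightarrow> real
     \<Rightarrow> ('m, 'n) chart \<Rightarrow> real \<Rightarrow> real^'n \<Rightarrow> real^('n option)^('n option)" where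
  "g_hat T g N s c t x =
     (let m = g t s c; m0 = g t 0 c;
          mixed = (\<lambda>i. W_low m m0 i x + pd i (log_det_ratio m m0) x / 2)
      in \<chi> a b. case (a, b) of
           (Some i, Some j) \<Rightarrow> m x $ i $ j
         | (Some i, None) \<Rightarrow> mixed i
         | (None, Some i) \<Rightarrow> mixed i
         | (None, None) \<Rightarrow>
             scal m x + W_norm2 m m0 x
             + vector_derivative (\<lambda>\<tau>. log_det_ratio (g \<tau> s c) (g \<tau> 0 c) x)
                 (at t within time_interval T)
             + N)"

definition h_tilde ::
  "(real \<Rightarrow> ('m, 'n::finite) tensor2) \<Rightarrow> (real \<Rightarrow> ('m, 'n) tensor2)
     \<Rightarrow> ('m, 'n) chart \<Rightarrow> real \<Rightarrow> real^'n \<Rightarrow> real^('n option)^('n option)" where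
  "h_tilde \<gamma> h c t x =
     (\<chi> a b. case (a, b) of
           (Some i, Some j) \<Rightarrow> h t c x $ i $ j
         | (Some i, None) \<Rightarrow> div2 (\<gamma> t c) (h t c) i x
         | (None, Some i) \<Rightarrow> div2 (\<gamma> t c) (h t c) i x
         | (None, None) \<Rightarrow> divdiv (\<gamma> t c) (h t c) x + ric_dot (\<gamma> t c) (h t c) x)"

end

theory Submission
  imports Defs
begin

text \<open>The \<open>00\<close>-component is reduced to a computation at fixed time: by the trace of the flow equation
  \<open>\<partial>\<^sub>t log det g(t,s) = -2 R + 2 div W\<close>, while \<open>\<partial>\<^sub>t log det g(t,0) = -2 R(t,0)\<close>. As \<open>W\<close> vanishes at
  \<open>s = 0\<close>, writing \<open>w = \<partial>\<^sub>s W\<close> one has to show \<open>- \<partial>\<^sub>s R + 2 div w = div (div h) + Rc \<cdot> h\<close>.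
  Let \<open>A\<close> be the variation of the Christoffel symbols and \<open>a = d (tr h) / 2\<close>. The contracted Palatini
  identity gives \<open>\<partial>\<^sub>s R = - Rc \<cdot> h + div w - div a\<close>, because \<open>w\<^sup>k = g\<^sup>i\<^sup>j A\<^sup>k\<^sub>i\<^sub>j\<close> and \<open>A\<^sup>p\<^sub>p\<^sub>k = a\<^sub>k\<close>, so
  everything follows from \<open>w + a = div h\<close>, which is also the assertion for the mixed components.
  Positivity is a Schur complement condition, a lower bound on \<open>N\<close> by a function that is
  continuous up to \<open>t = 0\<close>.\<close>

section \<open>Smooth functions\<close>

text \<open>The identity \<open>w + a = div h\<close> has a short reason: tracing the lowered
  variation \<open>g_lk A^k_ij\<close> gives the divergence of \<open>h\<close> minus half the
  gradient of \<open>tr h\<close>, and \<open>a\<close> restores that half gradient. The computation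
  runs in a chart with plain partial derivatives, so the products with Christoffel symbols that
  tensor calculus hides have to be cancelled explicitly; \<open>\<nabla> g = 0\<close> and
  \<open>\<nabla> g^-1 = 0\<close> serve this purpose. The other obstacle is analytic.
  \<open>\<partial>_s\<close> must be exchanged with spatial derivatives of quantities built from
  the metric, which needs their joint smoothness. At \<open>t = 0\<close> smoothness only means
  extendability, so it is established for families over an arbitrary parameter set, while the
  exchange happens at fixed \<open>t\<close>, where the parameter \<open>s\<close> runs through an
  open interval. \<open>\<partial>_t\<close> and \<open>\<partial>_s\<close> are never exchanged;
  this is what the trace of the flow equation buys. Joint smoothness in \<open>(t,s,x)\<close> is
  used again for the continuity that bounds \<open>N\<close>.\<close>

lemma Ck_on_SucD:
  assumes "Ck_on (Suc k) U f" shows "Ck_on k U f"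
  using assms
proof (induction k arbitrary: f)
  case 0
  then show ?case
    by (auto intro!: continuous_at_imp_continuous_on differentiable_imp_continuous_within)
next
  case (Suc k)
  then show ?case by (metis Ck_on.simps(2))
qed

lemma Ck_on_has_derivative:
  assumes "Ck_on (Suc k) U f" "x \<in> U"
  shows "(f has_derivative frechet_derivative f (at x)) (at x)"
  using assms by (simp add: frechet_derivative_works)

text \<open>Openness forces both functions to have the same Frechet derivative at every point of
  \<open>U\<close>, so the induction can pass to the derivatives.\<close>

lemma Ck_on_cong:
  assumes "open U" "Ck_on k U f" "\<And>x. x \<in> U \<Longrightarrow> f x = g x"
  shows "Ck_on k U g"
  using assms(2,3)
proof (induction k arbitrary: f g)
  case 0
  then show ?case by (simp cong: continuous_on_cong)
next
  case (Suc k)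
  have d: "(g has_derivative frechet_derivative f (at x)) (at x)" if "x \<in> U" for x
    using has_derivative_transform_within_open[OF Ck_on_has_derivative[OF Suc.prems(1) that] \<open>open U\<close> that]
      Suc.prems(2) by blast
  have "Ck_on k U (\<lambda>x. frechet_derivative g (at x) b)" if "b \<in> Basis" for b
    by (rule Suc.IH[of "\<lambda>x. frechet_derivative f (at x) b"])
      (use Suc.prems(1) that d frechet_derivative_at in \<open>force+\<close>)
  with d show ?case by (auto simp: differentiable_def)
qed

text \<open>\<open>Ck_on\<close> refers to the chosen \<open>frechet_derivative\<close>; by
  uniqueness of derivatives any explicit formula may take its place. The closure rules below
  differentiate through this rule.\<close>

lemma Ck_on_SucI:
  assumes "open U" "\<And>x. x \<in> U \<Longrightarrow> (f has_derivative f' x) (at x)"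
    and "\<And>b. b \<in> Basis \<Longrightarrow> Ck_on k U (\<lambda>x. f' x b)"
  shows "Ck_on (Suc k) U f"
proof -
  have "Ck_on k U (\<lambda>x. frechet_derivative f (at x) b)" if "b \<in> Basis" for b
    by (rule Ck_on_cong[OF assms(1) assms(3)[OF that]])
      (use assms(2) frechet_derivative_at in force)
  with assms(2) show ?thesis by (auto simp: differentiable_def)
qed

lemma Ck_on_subset:
  assumes "Ck_on k U f" "V \<subseteq> U" shows "Ck_on k V f"
  using assms
proof (induction k arbitrary: f)
  case 0 then show ?case using continuous_on_subset by auto
qed auto

lemma Ck_on_const: "Ck_on k U (\<lambda>_. c)"
  by (induction k arbitrary: c) auto

lemma Ck_on_add:
  assumes "open U" "Ck_on k U f" "Ck_on k U g"
  shows "Ck_on k U (\<lambda>x. f x + g x)"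
  using assms(2,3)
proof (induction k arbitrary: f g)
  case 0 then show ?case by (simp add: continuous_on_add)
next
  case (Suc k)
  show ?case
    by (rule Ck_on_SucI[OF \<open>open U\<close> has_derivative_add[OF Ck_on_has_derivative Ck_on_has_derivative]])
      (use Suc in auto)
qed

lemma Ck_on_bounded_linear:
  assumes "bounded_linear L" "open U" "Ck_on k U f"
  shows "Ck_on k U (\<lambda>x. L (f x))"
  using assms(3)
proof (induction k arbitrary: f)
  case 0 then show ?case
    by (simp add: bounded_linear.continuous_on[OF assms(1)])
next
  case (Suc k)
  show ?case
    by (rule Ck_on_SucI[OF \<open>open U\<close> bounded_linear.has_derivative[OF assms(1) Ck_on_has_derivative]])
      (use Suc in auto)
qed

lemma Ck_on_sum:
  assumes "open U" "\<And>i. i \<in> I \<Longrightarrow> Ck_on k U (f i)"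
  shows "Ck_on k U (\<lambda>x. \<Sum>i\<in>I. f i x)"
  using assms(2)
  by (induction I rule: infinite_finite_induct) (auto intro: Ck_on_add[OF assms(1)] Ck_on_const)

lemma Ck_on_mult:
  fixes f g :: "'a::euclidean_space \<Rightarrow> real"
  assumes "open U" "Ck_on k U f" "Ck_on k U g"
  shows "Ck_on k U (\<lambda>x. f x * g x)"
  using assms(2,3)
proof (induction k arbitrary: f g)
  case 0 then show ?case by (simp add: continuous_on_mult)
next
  case (Suc k)
  have "Ck_on k U f" "Ck_on k U g" using Suc.prems Ck_on_SucD by blast+
  then have "Ck_on k U (\<lambda>x. f x * frechet_derivative g (at x) b + frechet_derivative f (at x) b * g x)"
    if "b \<in> Basis" for b
    using that Suc.prems by (intro Ck_on_add[OF \<open>open U\<close>] Suc.IH) auto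
  then show ?case
    by (intro Ck_on_SucI[OF \<open>open U\<close> has_derivative_mult[OF Ck_on_has_derivative[OF Suc.prems(1)]
            Ck_on_has_derivative[OF Suc.prems(2)]]])
qed

text \<open>The derivative of \<open>1/f\<close> is a product of \<open>1/f\<close>, a derivative of
  \<open>f\<close> and \<open>1/f\<close> again, so the induction hypothesis for the same function
  \<open>f\<close> closes the step.\<close>

lemma Ck_on_inverse:
  fixes f :: "'a::euclidean_space \<Rightarrow> real"
  assumes "open U" "Ck_on k U f" "\<And>x. x \<in> U \<Longrightarrow> f x \<noteq> 0"
  shows "Ck_on k U (\<lambda>x. inverse (f x))"
  using assms(2)
proof (induction k)
  case 0 then show ?case using assms(3) by (simp add: continuous_on_inverse)
next
  case (Suc k)
  have I: "Ck_on k U (\<lambda>x. inverse (f x))" using Suc Ck_on_SucD by blast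
  have "Ck_on k U (\<lambda>x. (-1) * (inverse (f x) * frechet_derivative f (at x) b * inverse (f x)))"
    if "b \<in> Basis" for b
    using that Suc.prems by (intro Ck_on_mult[OF \<open>open U\<close>] I Ck_on_const) auto
  moreover have "((\<lambda>x. inverse (f x)) has_derivative
      (\<lambda>h. - (inverse (f x) * frechet_derivative f (at x) h * inverse (f x)))) (at x)" if "x \<in> U" for x
    using Deriv.has_derivative_inverse[OF assms(3)[OF that] Ck_on_has_derivative[OF Suc.prems that]] .
  ultimately show ?case
    by (intro Ck_on_SucI[OF \<open>open U\<close>]) auto
qed

lemma Ck_on_ln:
  fixes f :: "'a::euclidean_space \<Rightarrow> real"
  assumes "open U" "Ck_on k U f" "\<And>x. x \<in> U \<Longrightarrow> f x > 0"
  shows "Ck_on k U (\<lambda>x. ln (f x))"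
  using assms(2)
proof (cases k)
  case 0 then show ?thesis using assms by (auto intro!: continuous_on_ln) (metis order_less_irrefl)
next
  case (Suc l)
  have I: "Ck_on l U (\<lambda>x. inverse (f x))"
    using assms Suc by (intro Ck_on_inverse) (auto intro: Ck_on_SucD simp: less_imp_neq[symmetric])
  have "Ck_on l U (\<lambda>x. frechet_derivative f (at x) b * inverse (f x))" if "b \<in> Basis" for b
    using that assms Suc by (intro Ck_on_mult[OF \<open>open U\<close>] I) auto
  moreover have "((\<lambda>x. ln (f x)) has_derivative (\<lambda>h. frechet_derivative f (at x) h * inverse (f x))) (at x)"
    if "x \<in> U" for x
    using Ck_on_has_derivative[OF assms(2)[unfolded Suc] that] assms(3)[OF that]
    by (rule has_derivative_ln[rotated])
  ultimately show ?thesis unfolding Suc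
    by (intro Ck_on_SucI[OF \<open>open U\<close>])
qed

text \<open>The derivative \<open>D\<close> of \<open>L\<close> does not depend on the point, so the
  chain rule produces no new derivatives of \<open>L\<close>. This suffices for all the changes of
  parameters below.\<close>

lemma Ck_on_compose_affine:
  fixes f :: "'b::euclidean_space \<Rightarrow> 'c::real_normed_vector" and L :: "'a::euclidean_space \<Rightarrow> 'b"
  assumes "open U" "open V" "\<And>x. (L has_derivative D) (at x)" "L ` V \<subseteq> U" "Ck_on k U f"
  shows "Ck_on k V (\<lambda>x. f (L x))"
  using assms(5)
proof (induction k arbitrary: f)
  case 0
  have "continuous_on V L"
    using assms(3) by (meson continuous_at_imp_continuous_on has_derivative_continuous)
  with 0 show ?case using continuous_on_compose2 assms(4) by auto
next
  case (Suc k)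
  have d: "((\<lambda>x. f (L x)) has_derivative (\<lambda>h. frechet_derivative f (at (L x)) (D h))) (at x)"
    if "x \<in> V" for x
    by (rule has_derivative_compose[OF assms(3) Ck_on_has_derivative[OF Suc.prems]])
      (use that assms(4) in auto)
  \<comment> \<open>Differentiability of the derivative is known only in basis directions, hence the
    expansion of \<open>D b\<close> in the basis.\<close>
  have "Ck_on k V (\<lambda>x. \<Sum>b'\<in>Basis. (D b \<bullet> b') *\<^sub>R frechet_derivative f (at (L x)) b')"
    if "b \<in> Basis" for b
    using Suc by (intro Ck_on_sum[OF assms(2)] Ck_on_bounded_linear[OF bounded_linear_scaleR_right assms(2)]) auto
  moreover have "(\<Sum>b'\<in>Basis. (v \<bullet> b') *\<^sub>R frechet_derivative f (at (L x)) b')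
      = frechet_derivative f (at (L x)) v" if "x \<in> V" for x v
  proof -
    have "linear (frechet_derivative f (at (L x)))"
      using Suc.prems that assms(4) by (auto intro!: linear_frechet_derivative)
    then have "(\<Sum>b'\<in>Basis. (v \<bullet> b') *\<^sub>R frechet_derivative f (at (L x)) b')
        = frechet_derivative f (at (L x)) (\<Sum>b'\<in>Basis. (v \<bullet> b') *\<^sub>R b')"
      by (simp add: linear_sum linear_scale)
    then show ?thesis by (simp add: euclidean_representation)
  qed
  ultimately have "Ck_on k V (\<lambda>x. frechet_derivative f (at (L x)) (D b))" if "b \<in> Basis" for b
    using that by (auto intro: Ck_on_cong[OF assms(2)])
  then show ?case by (intro Ck_on_SucI[OF assms(2) d])
qed

section \<open>Smoothness by local extension on arbitrary sets\<close>

lemma smooth_onI: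
  assumes "\<And>p. p \<in> S \<Longrightarrow> \<exists>V F. open V \<and> p \<in> V \<and> (\<forall>k. Ck_on k V F) \<and> (\<forall>x\<in>S \<inter> V. F x = f x)"
  shows "smooth_on S f"
  using assms by (simp add: smooth_on_def)

lemma smooth_onE:
  assumes "smooth_on S f" "p \<in> S"
  obtains V F where "open V" "p \<in> V" "\<And>k. Ck_on k V F" "\<And>x. x \<in> S \<Longrightarrow> x \<in> V \<Longrightarrow> F x = f x"
  using assms unfolding smooth_on_def by (metis IntI)

lemma smooth_on_cong:
  assumes "\<And>x. x \<in> S \<Longrightarrow> f x = g x"
  shows "smooth_on S f \<longleftrightarrow> smooth_on S g"
  unfolding smooth_on_def using assms by (metis (no_types, lifting) IntE)

lemma smooth_on_const: "smooth_on S (\<lambda>_. c)"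
  by (rule smooth_onI, rule exI[of _ UNIV]) (auto intro!: exI[of _ "\<lambda>_. c"] Ck_on_const)

lemma smooth_on_bounded_linear:
  assumes "bounded_linear L" "smooth_on S f" shows "smooth_on S (\<lambda>x. L (f x))"
proof (rule smooth_onI)
  fix p assume "p \<in> S"
  then obtain V F where "open V" "p \<in> V" "\<And>k. Ck_on k V F" "\<And>x. x \<in> S \<Longrightarrow> x \<in> V \<Longrightarrow> F x = f x"
    using smooth_onE[OF assms(2)] by blast
  then show "\<exists>V F. open V \<and> p \<in> V \<and> (\<forall>k. Ck_on k V F) \<and> (\<forall>x\<in>S \<inter> V. F x = L (f x))"
    by (intro exI[of _ V] exI[of _ "\<lambda>x. L (F x)"]) (auto intro: Ck_on_bounded_linear[OF assms(1)])
qed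

text \<open>The two local extensions live on different neighbourhoods; both are restricted to the
  intersection.\<close>

lemma smooth_on_binary:
  fixes f :: "'a::euclidean_space \<Rightarrow> 'b::real_normed_vector" and g :: "'a \<Rightarrow> 'c::real_normed_vector"
    and op :: "'b \<Rightarrow> 'c \<Rightarrow> 'd::real_normed_vector"
  assumes "\<And>k (V :: 'a set) F G. open V \<Longrightarrow> Ck_on k V F \<Longrightarrow> Ck_on k V G \<Longrightarrow> Ck_on k V (\<lambda>x. op (F x) (G x))"
    and "smooth_on S f" "smooth_on S g"
  shows "smooth_on S (\<lambda>x. op (f x) (g x))"
proof (rule smooth_onI)
  fix p assume p: "p \<in> S"
  obtain V F where F: "open V" "p \<in> V" "\<And>k. Ck_on k V F" "\<And>x. x \<in> S \<Longrightarrow> x \<in> V \<Longrightarrow> F x = f x"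
    using smooth_onE[OF assms(2) p] by blast
  obtain U G where G: "open U" "p \<in> U" "\<And>k. Ck_on k U G" "\<And>x. x \<in> S \<Longrightarrow> x \<in> U \<Longrightarrow> G x = g x"
    using smooth_onE[OF assms(3) p] by blast
  have "Ck_on k (V \<inter> U) (\<lambda>x. op (F x) (G x))" for k
    by (intro assms(1)) (use F(1) G(1) in \<open>auto intro: Ck_on_subset[OF F(3)] Ck_on_subset[OF G(3)]\<close>)
  with F G show "\<exists>V F. open V \<and> p \<in> V \<and> (\<forall>k. Ck_on k V F) \<and> (\<forall>x\<in>S \<inter> V. F x = op (f x) (g x))"
    by (intro exI[of _ "V \<inter> U"] exI[of _ "\<lambda>x. op (F x) (G x)"]) auto
qed

lemma smooth_on_add: "smooth_on S f \<Longrightarrow> smooth_on S g \<Longrightarrow> smooth_on S (\<lambda>x. f x + g x)"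
  by (rule smooth_on_binary) (auto intro: Ck_on_add)

lemma smooth_on_mult:
  fixes f g :: "'a::euclidean_space \<Rightarrow> real"
  shows "smooth_on S f \<Longrightarrow> smooth_on S g \<Longrightarrow> smooth_on S (\<lambda>x. f x * g x)"
  by (rule smooth_on_binary) (auto intro: Ck_on_mult)

text \<open>Away from \<open>S\<close> the extension of \<open>f\<close> may leave the domain
  \<open>D\<close> of \<open>op\<close>, for instance vanish where an inverse is to be taken. The
  neighbourhood is therefore shrunk to the preimage of \<open>D\<close>.\<close>

lemma smooth_on_unary:
  fixes f :: "'a::euclidean_space \<Rightarrow> 'b::real_normed_vector" and op :: "'b \<Rightarrow> 'c::real_normed_vector"
  assumes "\<And>k V F. open V \<Longrightarrow> Ck_on k V F \<Longrightarrow> F ` V \<subseteq> D \<Longrightarrow> Ck_on k V (\<lambda>x::'a. op (F x))"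
    and "open D" "f ` S \<subseteq> D" "smooth_on S f"
  shows "smooth_on S (\<lambda>x. op (f x))"
proof (rule smooth_onI)
  fix p assume p: "p \<in> S"
  obtain V F where F: "open V" "p \<in> V" "\<And>k. Ck_on k V F" "\<And>x. x \<in> S \<Longrightarrow> x \<in> V \<Longrightarrow> F x = f x"
    using smooth_onE[OF assms(4) p] by blast
  have "continuous_on V F" using F(3)[of 0] by simp
  then have o: "open (V \<inter> F -` D)"
    using F(1) assms(2) by (simp add: continuous_on_open_vimage Int_commute)
  have "Ck_on k (V \<inter> F -` D) (\<lambda>x. op (F x))" for k
    by (intro assms(1) o) (auto intro: Ck_on_subset[OF F(3)])
  with F p assms(3) o show "\<exists>V F. open V \<and> p \<in> V \<and> (\<forall>k. Ck_on k V F) \<and> (\<forall>x\<in>S \<inter> V. F x = op (f x))"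
    by (intro exI[of _ "V \<inter> F -` D"] exI[of _ "\<lambda>x. op (F x)"]) auto
qed

lemma smooth_on_inverse:
  fixes f :: "'a::euclidean_space \<Rightarrow> real"
  assumes "smooth_on S f" "\<And>x. x \<in> S \<Longrightarrow> f x \<noteq> 0"
  shows "smooth_on S (\<lambda>x. inverse (f x))"
  by (rule smooth_on_unary[where D = "- {0}"]) (use assms in \<open>auto intro!: Ck_on_inverse\<close>)

lemma smooth_on_ln:
  fixes f :: "'a::euclidean_space \<Rightarrow> real"
  assumes "smooth_on S f" "\<And>x. x \<in> S \<Longrightarrow> f x > 0"
  shows "smooth_on S (\<lambda>x. ln (f x))"
  by (rule smooth_on_unary[where D = "{0<..}"]) (use assms in \<open>auto intro!: Ck_on_ln\<close>)

lemma smooth_on_compose_affine: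
  fixes f :: "'b::euclidean_space \<Rightarrow> 'c::real_normed_vector" and L :: "'a::euclidean_space \<Rightarrow> 'b"
  assumes "\<And>x. (L has_derivative D) (at x)" "L ` S \<subseteq> S'" "smooth_on S' f"
  shows "smooth_on S (\<lambda>x. f (L x))"
proof (rule smooth_onI)
  fix p assume p: "p \<in> S"
  then obtain V F where F: "open V" "L p \<in> V" "\<And>k. Ck_on k V F" "\<And>x. x \<in> S' \<Longrightarrow> x \<in> V \<Longrightarrow> F x = f x"
    using smooth_onE[OF assms(3), of "L p"] assms(2) by blast
  have "continuous_on UNIV L"
    using assms(1) by (meson continuous_at_imp_continuous_on has_derivative_continuous)
  then have o: "open (L -` V)" using F(1) by (simp add: open_vimage)
  have "Ck_on k (L -` V) (\<lambda>x. F (L x))" for k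
    by (rule Ck_on_compose_affine[OF F(1) o assms(1) _ F(3)]) auto
  with F p assms(2) o show "\<exists>V F. open V \<and> p \<in> V \<and> (\<forall>k. Ck_on k V F) \<and> (\<forall>x\<in>S \<inter> V. F x = f (L x))"
    by (intro exI[of _ "L -` V"] exI[of _ "\<lambda>x. F (L x)"]) auto
qed

lemma smooth_on_continuous_on:
  assumes "smooth_on S f" shows "continuous_on S f"
  unfolding continuous_on_eq_continuous_within
proof
  fix p assume p: "p \<in> S"
  then obtain V F where F: "open V" "p \<in> V" "\<And>k. Ck_on k V F" "\<And>x. x \<in> S \<Longrightarrow> x \<in> V \<Longrightarrow> F x = f x"
    using smooth_onE[OF assms] by blast
  have "isCont F p" using F(1-2) F(3)[of 0] by (simp add: continuous_on_eq_continuous_at)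
  then have c: "continuous (at p within S) F" by (simp add: continuous_at_imp_continuous_at_within)
  have "eventually (\<lambda>x. F x = f x) (at p within S)"
    using F(1,2,4) by (auto simp: eventually_at_topological)
  with c have "(f \<longlongrightarrow> F p) (at p within S)"
    by (auto simp: continuous_within intro: Lim_transform_eventually)
  then show "continuous (at p within S) f"
    using F p by (simp add: continuous_within)
qed

section \<open>Smooth families of functions\<close>

text \<open>The parameter (\<open>s\<close> or \<open>(t,s)\<close>) is kept apart from the
  coordinates so that \<open>pd\<close>, \<open>christoffel\<close> and the like apply to each slice
  \<open>f p\<close>. The set \<open>P\<close> may fail to be open, as it does at
  \<open>t = 0\<close>.\<close>

definition smooth_family ::
  "'p::euclidean_space set \<Rightarrow> (real^'n) set \<Rightarrow> ('p \<Rightarrow> real^'n \<Rightarrow> 'b::real_normed_vector) \<Rightarrow> bool" where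
  "smooth_family P B f \<longleftrightarrow> smooth_on (P \<times> B) (\<lambda>z. f (fst z) (snd z))"

lemma smooth_family_const: "smooth_family P B (\<lambda>_ _. c)"
  by (simp add: smooth_family_def smooth_on_const)

lemma smooth_family_add:
  "smooth_family P B f \<Longrightarrow> smooth_family P B g \<Longrightarrow> smooth_family P B (\<lambda>p x. f p x + g p x)"
  by (simp add: smooth_family_def smooth_on_add)

lemma smooth_family_mult:
  fixes f g :: "'p::euclidean_space \<Rightarrow> real^'n::finite \<Rightarrow> real"
  shows "smooth_family P B f \<Longrightarrow> smooth_family P B g \<Longrightarrow> smooth_family P B (\<lambda>p x. f p x * g p x)"
  by (simp add: smooth_family_def smooth_on_mult)

lemma smooth_family_diff:
  fixes f g :: "'p::euclidean_space \<Rightarrow> real^'n::finite \<Rightarrow> real"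
  assumes "smooth_family P B f" "smooth_family P B g"
  shows "smooth_family P B (\<lambda>p x. f p x - g p x)"
  using smooth_family_add[OF assms(1) smooth_family_mult[OF smooth_family_const[of _ _ "-1"] assms(2)]]
  by simp

lemma smooth_family_sum:
  assumes "\<And>i. i \<in> I \<Longrightarrow> smooth_family P B (f i)"
  shows "smooth_family P B (\<lambda>p x. \<Sum>i\<in>I. f i p x)"
  using assms
  by (induction I rule: infinite_finite_induct) (auto intro: smooth_family_add smooth_family_const)

lemma smooth_family_prod:
  fixes f :: "'i \<Rightarrow> 'p::euclidean_space \<Rightarrow> real^'n::finite \<Rightarrow> real"
  assumes "\<And>i. i \<in> I \<Longrightarrow> smooth_family P B (f i)"
  shows "smooth_family P B (\<lambda>p x. \<Prod>i\<in>I. f i p x)"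
  using assms
  by (induction I rule: infinite_finite_induct) (auto intro: smooth_family_mult smooth_family_const)

lemma smooth_family_divide:
  fixes f g :: "'p::euclidean_space \<Rightarrow> real^'n::finite \<Rightarrow> real"
  assumes "smooth_family P B f" "smooth_family P B g" "\<And>p x. p \<in> P \<Longrightarrow> x \<in> B \<Longrightarrow> g p x \<noteq> 0"
  shows "smooth_family P B (\<lambda>p x. f p x / g p x)"
  using assms unfolding smooth_family_def divide_inverse
  by (intro smooth_on_mult smooth_on_inverse) auto

lemma smooth_family_ln:
  fixes f :: "'p::euclidean_space \<Rightarrow> real^'n::finite \<Rightarrow> real"
  assumes "smooth_family P B f" "\<And>p x. p \<in> P \<Longrightarrow> x \<in> B \<Longrightarrow> f p x > 0"
  shows "smooth_family P B (\<lambda>p x. ln (f p x))"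
  using assms unfolding smooth_family_def by (intro smooth_on_ln) auto

lemma smooth_family_entry:
  assumes "smooth_family P B M"
  shows "smooth_family P B (\<lambda>p x. M p x $ i $ j)"
  using assms unfolding smooth_family_def
  by (rule smooth_on_bounded_linear[OF bounded_linear_compose[OF bounded_linear_vec_nth bounded_linear_vec_nth]])

lemma smooth_family_reparam:
  fixes f :: "'q::euclidean_space \<Rightarrow> real^'n::finite \<Rightarrow> 'b::real_normed_vector" and L :: "'p::euclidean_space \<Rightarrow> 'q"
  assumes "smooth_family P' B f" "\<And>p. (L has_derivative D) (at p)" "L ` P \<subseteq> P'"
  shows "smooth_family P B (\<lambda>p. f (L p))"
proof -
  have "((\<lambda>z. (L (fst z), snd z)) has_derivative (\<lambda>h. (D (fst h), snd h))) (at z)" for z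
    by (auto intro!: derivative_eq_intros has_derivative_compose[OF _ assms(2)])
  then have "smooth_on (P \<times> B) (\<lambda>z. (\<lambda>z. f (fst z) (snd z)) (L (fst z), snd z))"
    by (rule smooth_on_compose_affine) (use assms(1,3) in \<open>auto simp: smooth_family_def\<close>)
  then show ?thesis by (simp add: smooth_family_def)
qed

lemma smooth_family_det:
  fixes M :: "'p::euclidean_space \<Rightarrow> real^'n::finite \<Rightarrow> real^'k::finite^'k"
  assumes "\<And>i j. smooth_family P B (\<lambda>p x. M p x $ i $ j)"
  shows "smooth_family P B (\<lambda>p x. det (M p x))"
  unfolding det_def
  by (intro smooth_family_sum smooth_family_mult smooth_family_const smooth_family_prod assms)

section \<open>Partial derivatives, slicewise and in families\<close>

lemma pd_cong:
  assumes "open B" "x \<in> B" "\<And>y. y \<in> B \<Longrightarrow> f y = g y"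
  shows "pd i f x = pd i g x"
proof -
  have "continuous_on UNIV (\<lambda>r::real. x + r *\<^sub>R axis i 1)" by (intro continuous_intros)
  then have "open ((\<lambda>r::real. x + r *\<^sub>R axis i 1) -` B)" using assms(1) by (simp add: open_vimage)
  then have "\<forall>\<^sub>F r in nhds (0::real). f (x + r *\<^sub>R axis i 1) = g (x + r *\<^sub>R axis i 1)"
    unfolding eventually_nhds using assms(2,3)
    by (intro exI[of _ "(\<lambda>r::real. x + r *\<^sub>R axis i 1) -` B"]) auto
  then show ?thesis unfolding pd_def by (intro deriv_cong_ev) auto
qed

lemma has_derivative_directional:
  assumes "(F has_derivative F') (at q)"
  shows "((\<lambda>r. F (q + r *\<^sub>R b)) has_real_derivative F' b) (at 0)"
proof -
  have "((\<lambda>r. F (q + r *\<^sub>R b)) has_derivative (\<lambda>r. F' (r *\<^sub>R b))) (at (0::real))"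
    by (rule has_derivative_compose[where g=F and f="\<lambda>r. q + r *\<^sub>R b"])
      (auto intro!: derivative_eq_intros simp: assms)
  moreover have "(\<lambda>r. F' (r *\<^sub>R b)) = (*) (F' b)"
    using linear_scale[OF has_derivative_linear[OF assms]] by (auto simp: mult.commute)
  ultimately show ?thesis by (simp add: has_field_derivative_def)
qed

lemma pd_eq: "(f has_derivative f') (at x) \<Longrightarrow> pd i f x = f' (axis i 1)"
  unfolding pd_def by (intro DERIV_imp_deriv has_derivative_directional)

lemma has_pd:
  "f differentiable (at x) \<Longrightarrow> ((\<lambda>r. f (x + r *\<^sub>R axis i 1)) has_real_derivative pd i f x) (at 0)"
  by (metis differentiable_def has_derivative_directional pd_eq)

lemma pd_add:
  "f differentiable (at x) \<Longrightarrow> g differentiable (at x) \<Longrightarrow> pd i (\<lambda>y. f y + g y) x = pd i f x + pd i g x"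
  unfolding pd_def[of i "\<lambda>y. f y + g y"]
  by (rule DERIV_imp_deriv) (auto intro!: derivative_eq_intros has_pd)

lemma pd_diff:
  "f differentiable (at x) \<Longrightarrow> g differentiable (at x) \<Longrightarrow> pd i (\<lambda>y. f y - g y) x = pd i f x - pd i g x"
  unfolding pd_def[of i "\<lambda>y. f y - g y"]
  by (rule DERIV_imp_deriv) (auto intro!: derivative_eq_intros has_pd)

lemma pd_mult:
  "f differentiable (at x) \<Longrightarrow> g differentiable (at x) \<Longrightarrow>
    pd i (\<lambda>y. f y * g y) x = f x * pd i g x + pd i f x * g x"
  unfolding pd_def[of i "\<lambda>y. f y * g y"]
  by (rule DERIV_imp_deriv) (auto intro!: derivative_eq_intros has_pd)

lemma pd_const: "pd i (\<lambda>_. c) x = 0"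
  by (simp add: pd_def)

lemma pd_sum:
  "(\<And>k. k \<in> I \<Longrightarrow> f k differentiable (at x)) \<Longrightarrow> pd i (\<lambda>y. \<Sum>k\<in>I. f k y) x = (\<Sum>k\<in>I. pd i (f k) x)"
  unfolding pd_def[of i "\<lambda>y. \<Sum>k\<in>I. f k y"]
  by (rule DERIV_imp_deriv) (auto intro!: derivative_eq_intros has_pd)

lemma smooth_familyE:
  assumes "smooth_family P B f" "open B" "p \<in> P" "x \<in> B"
  obtains V F where "open V" "(p, x) \<in> V" "\<And>k. Ck_on k V F" "V \<subseteq> UNIV \<times> B"
    "\<And>q y. q \<in> P \<Longrightarrow> (q, y) \<in> V \<Longrightarrow> F (q, y) = f q y"
    "\<And>z. z \<in> V \<Longrightarrow> (F has_derivative frechet_derivative F (at z)) (at z)"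
proof -
  obtain V F where F: "open V" "(p, x) \<in> V" "\<And>k. Ck_on k V F"
    "\<And>z. z \<in> P \<times> B \<Longrightarrow> z \<in> V \<Longrightarrow> F z = f (fst z) (snd z)"
    using smooth_onE[OF assms(1)[unfolded smooth_family_def], of "(p, x)"] assms(3,4) by blast
  show ?thesis
  proof
    show "open (V \<inter> UNIV \<times> B)" using F assms by (auto intro: open_Times)
    show "Ck_on k (V \<inter> UNIV \<times> B) F" for k using Ck_on_subset[OF F(3)] by blast
    then show "(F has_derivative frechet_derivative F (at z)) (at z)" if "z \<in> V \<inter> UNIV \<times> B" for z
      using Ck_on_has_derivative that by blast
  qed (use F assms in auto)
qed

lemma axis_pair_in_Basis: "(0, axis i (1::real)) \<in> Basis"
  by (simp add: Basis_prod_def image_iff)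

lemma has_derivative_partial_snd:
  assumes "(F has_derivative F') (at (p, x))"
  shows "((\<lambda>y. F (p, y)) has_derivative (\<lambda>h. F' (0, h))) (at x)"
  by (rule has_derivative_compose[where g=F and f="\<lambda>y. (p, y)"]) (auto intro!: derivative_eq_intros assms)

text \<open>With \<open>p\<close> in \<open>P\<close> held fixed, \<open>f p\<close> and the
  extension \<open>F\<close> agree on an open set of coordinates, whatever \<open>P\<close> looks
  like near \<open>p\<close>. Spatial derivatives of \<open>f\<close> are therefore those of
  \<open>F\<close>, and these are smooth.\<close>

lemma smooth_family_has_derivative:
  fixes f :: "'p::euclidean_space \<Rightarrow> real^'n::finite \<Rightarrow> 'b::real_normed_vector"
  assumes "V \<subseteq> UNIV \<times> B" "open V" "p \<in> P" "(p, x) \<in> V"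
    "\<And>q y. q \<in> P \<Longrightarrow> (q, y) \<in> V \<Longrightarrow> F (q, y) = f q y"
    "\<And>z. z \<in> V \<Longrightarrow> (F has_derivative frechet_derivative F (at z)) (at z)"
  shows "(f p has_derivative (\<lambda>h. frechet_derivative F (at (p, x)) (0, h))) (at x)"
proof (rule has_derivative_transform_within_open)
  show "((\<lambda>y. F (p, y)) has_derivative (\<lambda>h. frechet_derivative F (at (p, x)) (0, h))) (at x)"
    by (rule has_derivative_partial_snd) (use assms in auto)
  have "continuous_on UNIV (\<lambda>y::real^'n. (p, y))" by (intro continuous_intros)
  then show "open ((\<lambda>y. (p, y)) -` V)" using assms(2) by (simp add: open_vimage)
qed (use assms in auto)

lemma smooth_family_differentiable:
  fixes f :: "'p::euclidean_space \<Rightarrow> real^'n::finite \<Rightarrow> 'b::real_normed_vector"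
  assumes "smooth_family P B f" "open B" "p \<in> P" "x \<in> B"
  shows "f p differentiable (at x)"
proof -
  obtain V F where F: "open V" "(p, x) \<in> V" "\<And>k. Ck_on k V F" "V \<subseteq> UNIV \<times> B"
    "\<And>q y. q \<in> P \<Longrightarrow> (q, y) \<in> V \<Longrightarrow> F (q, y) = f q y"
    "\<And>z. z \<in> V \<Longrightarrow> (F has_derivative frechet_derivative F (at z)) (at z)"
    using smooth_familyE[OF assms] by blast
  show ?thesis
    unfolding differentiable_def
    by (rule exI) (rule smooth_family_has_derivative[OF F(4,1) assms(3) F(2,5,6)])
qed

lemma smooth_family_pd:
  fixes f :: "'p::euclidean_space \<Rightarrow> real^'n::finite \<Rightarrow> real"
  assumes f: "smooth_family P B f" and B: "open B"
  shows "smooth_family P B (\<lambda>p. pd i (f p))"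
  unfolding smooth_family_def
proof (rule smooth_onI, clarify, goal_cases)
  case (1 p x)
  obtain V F where F: "open V" "(p, x) \<in> V" "\<And>k. Ck_on k V F" "V \<subseteq> UNIV \<times> B"
    "\<And>q y. q \<in> P \<Longrightarrow> (q, y) \<in> V \<Longrightarrow> F (q, y) = f q y"
    "\<And>z. z \<in> V \<Longrightarrow> (F has_derivative frechet_derivative F (at z)) (at z)"
    using smooth_familyE[OF f B 1] by blast
  have "frechet_derivative F (at (q, y)) (0, axis i 1) = pd i (f q) y" if "q \<in> P" "(q, y) \<in> V" for q y
    using pd_eq[OF smooth_family_has_derivative[OF F(4,1) that F(5,6)]] by simp
  moreover have "Ck_on k V (\<lambda>z. frechet_derivative F (at z) (0, axis i 1))" for k
    using F(3)[of "Suc k"] axis_pair_in_Basis by auto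
  ultimately show ?case using F(1,2)
    by (intro exI[of _ V] exI[of _ "\<lambda>z. frechet_derivative F (at z) (0, axis i 1)"]) auto
qed

text \<open>Schwarz's theorem. Two applications of the mean value theorem show that the second
  difference of \<open>f\<close> with step \<open>h\<close> is \<open>h^2\<close> times a nearby
  value of \<open>AB\<close>; with the directions interchanged it is \<open>h^2\<close> times a
  nearby value of \<open>BA\<close>. Continuity at \<open>p\<close> then excludes a gap.\<close>

lemma mixed_directional_derivatives_eq:
  fixes f :: "'a::real_normed_vector \<Rightarrow> real"
  assumes V: "open V" "p \<in> V"
    and A: "\<And>q. q \<in> V \<Longrightarrow> ((\<lambda>r. f (q + r *\<^sub>R a)) has_real_derivative A q) (at 0)"
    and B: "\<And>q. q \<in> V \<Longrightarrow> ((\<lambda>r. f (q + r *\<^sub>R b)) has_real_derivative B q) (at 0)"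
    and AB: "\<And>q. q \<in> V \<Longrightarrow> ((\<lambda>r. A (q + r *\<^sub>R b)) has_real_derivative AB q) (at 0)"
    and BA: "\<And>q. q \<in> V \<Longrightarrow> ((\<lambda>r. B (q + r *\<^sub>R a)) has_real_derivative BA q) (at 0)"
    and cont: "isCont AB p" "isCont BA p"
  shows "AB p = BA p"
proof (rule ccontr)
  \<comment> \<open>The hypotheses give derivatives only at parameter 0, but from every base point
    of \<open>V\<close>. Moving the base point along the line gives them at the other parameters, as
    the mean value theorem requires.\<close>
  have shift: "((\<lambda>r. g (c + r *\<^sub>R v)) has_real_derivative G (c + r0 *\<^sub>R v)) (at r0)"
    if "\<And>q. q \<in> V \<Longrightarrow> ((\<lambda>r. g (q + r *\<^sub>R v)) has_real_derivative G q) (at 0)" "c + r0 *\<^sub>R v \<in> V"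
    for g G :: "'a \<Rightarrow> real" and c v r0
  proof -
    have "((\<lambda>r. g (c + (r0 + r) *\<^sub>R v)) has_real_derivative G (c + r0 *\<^sub>R v)) (at 0)"
      using that(1)[OF that(2)] by (simp add: scaleR_add_left add.assoc)
    then show ?thesis using DERIV_shift[of "\<lambda>r. g (c + r *\<^sub>R v)" _ 0 r0] by (simp add: add.commute)
  qed
  have double_mvt: "\<exists>\<xi> \<eta>. 0 < \<xi> \<and> \<xi> < h \<and> 0 < \<eta> \<and> \<eta> < h \<and>
      f (p + h *\<^sub>R a + h *\<^sub>R b) - f (p + h *\<^sub>R a) - f (p + h *\<^sub>R b) + f p
        = h * (h * AB (p + \<xi> *\<^sub>R a + \<eta> *\<^sub>R b))"
    if h: "h > 0" and inV: "\<And>\<xi> \<eta>. 0 \<le> \<xi> \<Longrightarrow> \<xi> \<le> h \<Longrightarrow> 0 \<le> \<eta> \<Longrightarrow> \<eta> \<le> h \<Longrightarrow> p + \<xi> *\<^sub>R a + \<eta> *\<^sub>R b \<in> V"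
      and A: "\<And>q. q \<in> V \<Longrightarrow> ((\<lambda>r. f (q + r *\<^sub>R a)) has_real_derivative A q) (at 0)"
      and AB: "\<And>q. q \<in> V \<Longrightarrow> ((\<lambda>r. A (q + r *\<^sub>R b)) has_real_derivative AB q) (at 0)"
    for h and a b :: 'a and A AB
  proof -
    let ?\<phi> = "\<lambda>\<xi>. f (p + h *\<^sub>R b + \<xi> *\<^sub>R a) - f (p + \<xi> *\<^sub>R a)"
    have "(?\<phi> has_real_derivative A (p + h *\<^sub>R b + \<xi> *\<^sub>R a) - A (p + \<xi> *\<^sub>R a)) (at \<xi>)"
      if "0 \<le> \<xi>" "\<xi> \<le> h" for \<xi>
    proof -
      have "p + h *\<^sub>R b + \<xi> *\<^sub>R a \<in> V" "p + \<xi> *\<^sub>R a \<in> V"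
        using that h inV[of \<xi> h] inV[of \<xi> 0] by (simp_all add: ac_simps)
      then show ?thesis 
        by (intro DERIV_diff) (rule shift[where v=a and g=f and G=A], rule A, assumption+)+
    qed
    then obtain \<xi> where \<xi>: "0 < \<xi>" "\<xi> < h"
      and 1: "?\<phi> h - ?\<phi> 0 = h * (A (p + h *\<^sub>R b + \<xi> *\<^sub>R a) - A (p + \<xi> *\<^sub>R a))"
      using MVT2[OF h, of ?\<phi> "\<lambda>\<xi>. A (p + h *\<^sub>R b + \<xi> *\<^sub>R a) - A (p + \<xi> *\<^sub>R a)"]
      by (metis (no_types, lifting) diff_zero)
    have "((\<lambda>\<eta>. A (p + \<xi> *\<^sub>R a + \<eta> *\<^sub>R b)) has_real_derivative AB (p + \<xi> *\<^sub>R a + \<eta> *\<^sub>R b)) (at \<eta>)"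
      if "0 \<le> \<eta>" "\<eta> \<le> h" for \<eta>
      by (rule shift[where v=b and g=A and G=AB]) (use that \<xi> in \<open>auto intro: AB inV\<close>)
    then obtain \<eta> where "0 < \<eta>" "\<eta> < h"
      and 2: "A (p + \<xi> *\<^sub>R a + h *\<^sub>R b) - A (p + \<xi> *\<^sub>R a + 0 *\<^sub>R b) = h * AB (p + \<xi> *\<^sub>R a + \<eta> *\<^sub>R b)"
      using MVT2[OF h, of "\<lambda>\<eta>. A (p + \<xi> *\<^sub>R a + \<eta> *\<^sub>R b)" "\<lambda>\<eta>. AB (p + \<xi> *\<^sub>R a + \<eta> *\<^sub>R b)"]
      by auto
    with \<xi> 1 show ?thesis
      by (intro exI[of _ \<xi>] exI[of _ \<eta>]) (simp add: algebra_simps)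
  qed
  assume ne: "AB p \<noteq> BA p"
  define e where "e = \<bar>AB p - BA p\<bar> / 2"
  have e: "e > 0" using ne by (simp add: e_def)
  obtain d1 where d1: "d1 > 0" "\<And>q. dist q p < d1 \<Longrightarrow> dist (AB q) (AB p) < e"
    using cont(1) e unfolding continuous_at_eps_delta dist_norm by metis
  obtain d2 where d2: "d2 > 0" "\<And>q. dist q p < d2 \<Longrightarrow> dist (BA q) (BA p) < e"
    using cont(2) e unfolding continuous_at_eps_delta dist_norm by metis
  obtain d3 where d3: "d3 > 0" "\<And>q. dist q p < d3 \<Longrightarrow> q \<in> V"
    using V by (metis dist_commute mem_ball open_contains_ball subsetD)
  define d where "d = min d1 (min d2 d3)"
  have d: "d > 0" using d1 d2 d3 by (simp add: d_def)
  \<comment> \<open>This makes \<open>h * k = d / 2\<close>, so all points reached with both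
    parameters at most \<open>h\<close> stay within \<open>d\<close> of \<open>p\<close>. The
    summand 1 keeps \<open>k\<close> positive when both directions vanish.\<close>
  define k where "k = norm a + norm b + 1"
  have k: "k > 0" unfolding k_def by (auto simp: add_nonneg_pos)
  define h where "h = d / (2 * k)"
  have h: "h > 0" unfolding h_def using d k by simp
  have near: "dist (p + \<xi> *\<^sub>R a + \<eta> *\<^sub>R b) p < d" if "0 \<le> \<xi>" "\<xi> \<le> h" "0 \<le> \<eta>" "\<eta> \<le> h" for \<xi> \<eta>
  proof -
    have "dist (p + \<xi> *\<^sub>R a + \<eta> *\<^sub>R b) p = norm (\<xi> *\<^sub>R a + \<eta> *\<^sub>R b)" by (simp add: dist_norm add.assoc)
    also have "\<dots> \<le> \<xi> * norm a + \<eta> * norm b" using that by (intro norm_triangle_le) simp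
    also have "\<dots> \<le> h * norm a + h * norm b" using that by (intro add_mono mult_right_mono) auto
    also have "\<dots> \<le> h * k" using h by (simp add: k_def algebra_simps)
    also have "\<dots> = d / 2" using k by (simp add: h_def)
    finally show ?thesis using d by simp
  qed
  then have inV: "p + \<xi> *\<^sub>R a + \<eta> *\<^sub>R b \<in> V" if "0 \<le> \<xi>" "\<xi> \<le> h" "0 \<le> \<eta>" "\<eta> \<le> h" for \<xi> \<eta>
    using d3 that by (fastforce simp: d_def)
  obtain \<xi> \<eta> where 1: "0 < \<xi>" "\<xi> < h" "0 < \<eta>" "\<eta> < h"
      "f (p + h *\<^sub>R a + h *\<^sub>R b) - f (p + h *\<^sub>R a) - f (p + h *\<^sub>R b) + f p
        = h * (h * AB (p + \<xi> *\<^sub>R a + \<eta> *\<^sub>R b))"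
    using double_mvt[OF h inV A AB] by blast
  have inV': "p + \<xi> *\<^sub>R b + \<eta> *\<^sub>R a \<in> V" if "0 \<le> \<xi>" "\<xi> \<le> h" "0 \<le> \<eta>" "\<eta> \<le> h" for \<xi> \<eta>
    using inV[of \<eta> \<xi>] that by (simp add: algebra_simps)
  obtain \<xi>' \<eta>' where 2: "0 < \<xi>'" "\<xi>' < h" "0 < \<eta>'" "\<eta>' < h"
      "f (p + h *\<^sub>R b + h *\<^sub>R a) - f (p + h *\<^sub>R b) - f (p + h *\<^sub>R a) + f p
        = h * (h * BA (p + \<xi>' *\<^sub>R b + \<eta>' *\<^sub>R a))"
    using double_mvt[OF h inV' B BA] by blast
  have "h * (h * AB (p + \<xi> *\<^sub>R a + \<eta> *\<^sub>R b)) = h * (h * BA (p + \<eta>' *\<^sub>R a + \<xi>' *\<^sub>R b))"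
    using 1(5) 2(5) by (simp add: algebra_simps)
  then have "AB (p + \<xi> *\<^sub>R a + \<eta> *\<^sub>R b) = BA (p + \<eta>' *\<^sub>R a + \<xi>' *\<^sub>R b)" using h by simp
  moreover have "dist (AB (p + \<xi> *\<^sub>R a + \<eta> *\<^sub>R b)) (AB p) < e"
    using near[of \<xi> \<eta>] 1 d1(2) by (simp add: d_def)
  moreover have "dist (BA (p + \<eta>' *\<^sub>R a + \<xi>' *\<^sub>R b)) (BA p) < e"
    using near[of \<eta>' \<xi>'] 2 d2(2) by (simp add: d_def)
  ultimately have "\<bar>AB p - BA p\<bar> < 2 * e" by (simp add: dist_real_def)
  then show False by (simp add: e_def)
qed

section \<open>Exchange of derivatives, inverse matrices and determinants\<close>

text \<open>Here \<open>P\<close> is open, so \<open>f\<close> coincides with its extension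
  \<open>F\<close> on a full neighbourhood. Both first derivatives become directional derivatives of
  \<open>F\<close> along basis vectors, and Schwarz's theorem exchanges them.\<close>

lemma smooth_family_exchange:
  fixes f :: "real \<Rightarrow> real^'n::finite \<Rightarrow> real"
  assumes f: "smooth_family P B f" and "open P" "open B" "s \<in> P" "x \<in> B"
  shows smooth_family_has_deriv: "((\<lambda>s. f s x) has_real_derivative deriv (\<lambda>s. f s x) s) (at s)"
    and smooth_family_deriv_differentiable: "(\<lambda>y. deriv (\<lambda>s. f s y) s) differentiable (at x)"
    and smooth_family_deriv_pd:
      "((\<lambda>s. pd i (f s) x) has_real_derivative pd i (\<lambda>y. deriv (\<lambda>s. f s y) s) x) (at s)"
proof -
  obtain V0 F where F0: "open V0" "(s, x) \<in> V0" "\<And>k. Ck_on k V0 F" "V0 \<subseteq> UNIV \<times> B"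
    "\<And>q y. q \<in> P \<Longrightarrow> (q, y) \<in> V0 \<Longrightarrow> F (q, y) = f q y"
    "\<And>z. z \<in> V0 \<Longrightarrow> (F has_derivative frechet_derivative F (at z)) (at z)"
    using smooth_familyE[OF f \<open>open B\<close> \<open>s \<in> P\<close> \<open>x \<in> B\<close>] by blast
  \<comment> \<open>Intersecting with \<open>P\<close> makes \<open>F\<close> equal to
    \<open>f\<close> on all of \<open>V\<close>, so that derivatives in \<open>s\<close> can be
    transferred as well.\<close>
  define V where "V = V0 \<inter> P \<times> UNIV"
  have V: "open V" "(s, x) \<in> V" "V \<subseteq> UNIV \<times> B" "V \<subseteq> P \<times> UNIV" "V \<subseteq> V0"
    using F0 assms by (auto simp: V_def intro!: open_Times)
  have F: "F (q, y) = f q y" if "(q, y) \<in> V" for q y using F0(5) V(4,5) that by blast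
  let ?d = "\<lambda>b z. frechet_derivative F (at z) b"
  let ?s = "(1, 0) :: real \<times> (real^'n)" and ?x = "(0, axis i 1) :: real \<times> (real^'n)"
  have basis: "?s \<in> Basis" "?x \<in> Basis" by (auto simp: Basis_prod_def image_iff)
  have C: "Ck_on k V (?d ?s)" "Ck_on k V (?d ?x)" for k
    using F0(3)[of "Suc k"] V(5) basis by (auto intro: Ck_on_subset)
  have dd: "(?d b has_derivative frechet_derivative (?d b) (at z)) (at z)" if "b \<in> {?s, ?x}" "z \<in> V" for b z
    using that C[of "Suc 0"] Ck_on_has_derivative by blast
  have slice: "((\<lambda>r. G (r, y)) has_real_derivative frechet_derivative G (at (q, y)) ?s) (at q)"
    if "(G has_derivative frechet_derivative G (at (q, y))) (at (q, y))" for G :: "real \<times> (real^'n) \<Rightarrow> real" and q y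
    using has_derivative_directional[OF that, of ?s] DERIV_shift[of "\<lambda>r. G (r, y)" _ 0 q]
    by (simp add: add.commute)
  have nhd: "open ((\<lambda>r. (r, y)) -` V)" "open (Pair q -` V)" for y q
    using V(1) by (auto intro!: open_vimage continuous_intros)
  have D1: "((\<lambda>r. f r y) has_real_derivative ?d ?s (q, y)) (at q)" if "(q, y) \<in> V" for q y
    by (rule has_field_derivative_transform_within_open[OF slice nhd(1)[of y]])
      (use that F0(6) V(5) F in auto)
  then have ds: "deriv (\<lambda>r. f r y) q = ?d ?s (q, y)" if "(q, y) \<in> V" for q y
    using that DERIV_imp_deriv by blast
  have px: "pd i (f q) y = ?d ?x (q, y)" if "(q, y) \<in> V" for q y
  proof -
    have "(f q has_derivative (\<lambda>h. frechet_derivative F (at (q, y)) (0, h))) (at y)"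
      by (rule smooth_family_has_derivative[OF F0(4,1) _ _ F0(5,6)]) (use V(4,5) that in auto)
    then show ?thesis by (rule pd_eq)
  qed
  show "((\<lambda>s. f s x) has_real_derivative deriv (\<lambda>s. f s x) s) (at s)"
    using D1[OF V(2)] ds[OF V(2)] by simp
  have A: "((\<lambda>y. deriv (\<lambda>s. f s y) s) has_derivative (\<lambda>h. frechet_derivative (?d ?s) (at (s, x)) (0, h))) (at x)"
    by (rule has_derivative_transform_within_open[OF has_derivative_partial_snd nhd(2)[of s]])
      (use dd V(2) ds in auto)
  then show "(\<lambda>y. deriv (\<lambda>s. f s y) s) differentiable (at x)" by (rule differentiableI)
  have dF: "((\<lambda>r. F (z + r *\<^sub>R b)) has_real_derivative ?d b z) (at 0)" if "z \<in> V" for z b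
    using has_derivative_directional[OF F0(6)] V(5) that by blast
  have ddF: "((\<lambda>r. ?d b (z + r *\<^sub>R b')) has_real_derivative frechet_derivative (?d b) (at z) b') (at 0)"
    if "b \<in> {?s, ?x}" "z \<in> V" for z b b'
    using has_derivative_directional[OF dd[OF that]] .
  have "frechet_derivative (?d ?s) (at (s, x)) ?x = frechet_derivative (?d ?x) (at (s, x)) ?s"
  proof (rule mixed_directional_derivatives_eq[OF V(1,2),
        where f = F and A = "?d ?s" and B = "?d ?x" and a = ?s and b = ?x])
    show "isCont (\<lambda>z. frechet_derivative (?d ?s) (at z) ?x) (s, x)"
      "isCont (\<lambda>z. frechet_derivative (?d ?x) (at z) ?s) (s, x)"
      using C[of "Suc 0"] basis V(1,2) by (auto simp: continuous_on_eq_continuous_at)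
  qed (rule dF ddF; simp)+
  moreover have "((\<lambda>s. pd i (f s) x) has_real_derivative frechet_derivative (?d ?x) (at (s, x)) ?s) (at s)"
    by (rule has_field_derivative_transform_within_open[OF slice nhd(1)[of x]])
      (use dd V(2) px in auto)
  ultimately show "((\<lambda>s. pd i (f s) x) has_real_derivative pd i (\<lambda>y. deriv (\<lambda>s. f s y) s) x) (at s)"
    using pd_eq[OF A, of i] by simp
qed

section \<open>Inverse matrices, determinants and positive definiteness\<close>

lemma matrix_inv_inverse:
  fixes M :: "real^'k::finite^'k"
  assumes "det M \<noteq> 0"
  shows "M ** matrix_inv M = mat 1" "matrix_inv M ** M = mat 1"
proof -
  have "\<exists>N. M ** N = mat 1 \<and> N ** M = mat 1"
    using assms by (simp add: invertible_det_nz[symmetric] invertible_def)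
  from someI_ex[OF this] show "M ** matrix_inv M = mat 1" "matrix_inv M ** M = mat 1"
    by (simp_all add: matrix_inv_def)
qed

lemma matrix_inv_contract:
  fixes M :: "real^'k::finite^'k"
  assumes "det M \<noteq> 0"
  shows "(\<Sum>k\<in>UNIV. M $ i $ k * matrix_inv M $ k $ j) = (if i = j then 1 else 0)"
    and "(\<Sum>k\<in>UNIV. matrix_inv M $ i $ k * M $ k $ j) = (if i = j then 1 else 0)"
  using matrix_inv_inverse[OF assms]
  by (auto simp: matrix_matrix_mult_def mat_def vec_eq_iff)

text \<open>This writes the entries of the inverse as quotients of polynomials in the entries of
  \<open>M\<close>, from which the smoothness of \<open>ginv\<close> follows.\<close>

lemma matrix_inv_cramer:
  fixes M :: "real^'k::finite^'k"
  assumes "det M \<noteq> 0"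
  shows "matrix_inv M $ i $ j
    = det (\<chi> a b. if b = i then if a = j then 1 else 0 else M $ a $ b) / det M"
proof -
  have "M *v column j (matrix_inv M) = (\<chi> a. if a = j then 1 else 0)"
    using matrix_inv_contract(1)[OF assms]
    by (simp add: matrix_vector_mult_def column_def vec_eq_iff)
  then have "column j (matrix_inv M) =
     (\<chi> k. det (\<chi> a b. if b = k then (\<chi> a. if a = j then 1 else 0) $ a else M $ a $ b) / det M)"
    using cramer[OF assms] by blast
  then have "column j (matrix_inv M) $ i = 
     det (\<chi> a b. if b = i then (\<chi> a. if a = j then 1 else 0) $ a else M $ a $ b) / det M" by simp
  then show ?thesis by (simp add: column_def cong: if_cong)
qed

lemma matrix_inv_sym:
  fixes M :: "real^'k::finite^'k"
  assumes "det M \<noteq> 0" "transpose M = M"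
  shows "matrix_inv M $ i $ j = matrix_inv M $ j $ i"
proof -
  let ?N = "matrix_inv M"
  have "transpose ?N ** M = mat 1"
    using arg_cong[OF matrix_inv_inverse(1)[OF assms(1)], of transpose] assms(2)
    by (simp add: matrix_transpose_mul)
  then have "(transpose ?N ** M) ** ?N = ?N" by simp
  then have "transpose ?N = ?N"
    by (simp add: matrix_mul_assoc[symmetric] matrix_inv_inverse[OF assms(1)])
  then have "transpose ?N $ j $ i = ?N $ j $ i" by simp
  then show ?thesis by (simp add: transpose_def)
qed

lemma positive_definite_det_nonzero:
  assumes "positive_definite M" shows "det M \<noteq> 0"
proof
  assume "det M = 0"
  then obtain v where "v \<noteq> 0" "M *v v = 0"
    using matrix_left_invertible_ker[of M] invertible_left_inverse[of M] by (auto simp: invertible_det_nz)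
  then show False using assms by (auto simp: positive_definite_def)
qed

text \<open>The segment from the identity to \<open>M\<close> consists of positive definite, hence
  nonsingular, matrices. By the intermediate value theorem the determinant keeps the sign it has at
  the identity.\<close>

lemma positive_definite_det_pos:
  fixes M :: "real^'k::finite^'k"
  assumes "positive_definite M" shows "det M > 0"
proof (rule ccontr)
  define K where "K u = (1 - u) *\<^sub>R mat 1 + u *\<^sub>R M" for u :: real
  have pd: "positive_definite (K u)" if "0 \<le> u" "u \<le> 1" for u
    unfolding positive_definite_def
  proof (intro conjI allI impI)
    have "transpose M = M" using assms by (simp add: positive_definite_def)
    then have "transpose M $ i $ j = M $ i $ j" for i j by simp
    then have "M $ j $ i = M $ i $ j" for i j by (simp add: transpose_def)
    then show "transpose (K u) = K u"
      by (simp add: K_def transpose_def vec_eq_iff mat_def)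
    fix v :: "real^'k" assume v: "v \<noteq> 0"
    have "K u *v v = (1 - u) *\<^sub>R v + u *\<^sub>R (M *v v)"
      by (simp add: K_def matrix_vector_mult_add_rdistrib scaleR_matrix_vector_assoc[symmetric])
    then have *: "v \<bullet> (K u *v v) = (1 - u) * (v \<bullet> v) + u * (v \<bullet> (M *v v))"
      by (simp add: inner_add_right)
    have "v \<bullet> (M *v v) > 0" using assms v by (simp add: positive_definite_def)
    moreover have "v \<bullet> v > 0" using v by simp
    ultimately show "v \<bullet> (K u *v v) > 0"
      unfolding * using that
      by (cases "u = 0") (auto intro!: add_nonneg_pos mult_nonneg_nonneg)
  qed
  assume "\<not> det M > 0"
  then have "det (K 1) \<le> 0" "0 \<le> det (K 0)" by (simp_all add: K_def)
  moreover have "continuous_on {0..1} (\<lambda>u. det (K u))"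
    unfolding K_def det_def by (intro continuous_intros)
  ultimately obtain u where "0 \<le> u" "u \<le> 1" "det (K u) = 0"
    using IVT2'[of "\<lambda>u. det (K u)" 1 0 0] by auto
  with pd positive_definite_det_nonzero show False by blast
qed

text \<open>Jacobi's formula. The Leibniz expansion, differentiated, is a sum over \<open>k\<close>
  of determinants with row \<open>k\<close> replaced by its derivative, and Cramer's rule for rows
  evaluates each of them. The set \<open>I\<close> admits the one-sided time derivative at
  0.\<close>

lemma has_real_derivative_det:
  fixes M :: "real \<Rightarrow> real^'k::finite^'k"
  assumes M: "\<And>i j. ((\<lambda>r. M r $ i $ j) has_real_derivative M' i j) (at t within I)"
    and nz: "det (M t) \<noteq> 0"
  shows "((\<lambda>r. det (M r)) has_real_derivative
           det (M t) * (\<Sum>i\<in>UNIV. \<Sum>j\<in>UNIV. matrix_inv (M t) $ i $ j * M' j i)) (at t within I)"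
proof -
  let ?A = "M t" and ?P = "{p. p permutes (UNIV :: 'k set)}"
  have D: "((\<lambda>r. det (M r)) has_real_derivative (\<Sum>p\<in>?P. of_int (sign p) *
          (\<Sum>k\<in>UNIV. M' k (p k) * (\<Prod>i\<in>UNIV - {k}. ?A $ i $ p i)))) (at t within I)"
    unfolding det_def
  proof (intro DERIV_sum DERIV_cmult)
    fix p :: "'k \<Rightarrow> 'k"
    show "((\<lambda>r. \<Prod>i\<in>UNIV. M r $ i $ p i) has_real_derivative
        (\<Sum>k\<in>UNIV. M' k (p k) * (\<Prod>i\<in>UNIV - {k}. ?A $ i $ p i))) (at t within I)"
      unfolding has_field_derivative_def
      by (rule has_derivative_eq_rhs[OF has_derivative_prod[OF M[unfolded has_field_derivative_def]]])
        (simp add: sum_distrib_left sum_distrib_right ac_simps fun_eq_iff)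
  qed
  have row: "det (\<chi> i. if i = k then v else row i ?A)
      = (\<Sum>p\<in>?P. of_int (sign p) * (v $ p k * (\<Prod>i\<in>UNIV - {k}. ?A $ i $ p i)))" for k v
    unfolding det_def
  proof (rule sum.cong, rule refl)
    fix p
    have "(\<Prod>i\<in>UNIV. (\<chi> i. if i = k then v else row i ?A) $ i $ p i)
       = v $ p k * (\<Prod>i\<in>UNIV - {k}. (\<chi> i. if i = k then v else row i ?A) $ i $ p i)"
      by (subst prod.remove[of _ k]) auto
    also have "(\<Prod>i\<in>UNIV - {k}. (\<chi> i. if i = k then v else row i ?A) $ i $ p i) = (\<Prod>i\<in>UNIV - {k}. ?A $ i $ p i)"
      by (rule prod.cong) (auto simp: row_def)
    finally show "of_int (sign p) * (\<Prod>i\<in>UNIV. (\<chi> i. if i = k then v else row i ?A) $ i $ p i)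
      = of_int (sign p) * (v $ p k * (\<Prod>i\<in>UNIV - {k}. ?A $ i $ p i))" by simp
  qed
  have k: "(\<Sum>p\<in>?P. of_int (sign p) * (M' k (p k) * (\<Prod>i\<in>UNIV - {k}. ?A $ i $ p i)))
      = (\<Sum>j\<in>UNIV. matrix_inv ?A $ j $ k * M' k j) * det ?A" for k
  proof -
    \<comment> \<open>These are the coefficients of the differentiated row \<open>k\<close> with
      respect to the rows of \<open>?A\<close>, that is, this row times the inverse.\<close>
    define x where "x = (\<chi> i. \<Sum>j\<in>UNIV. M' k j * matrix_inv ?A $ j $ i)"
    have "(\<Sum>i\<in>UNIV. x $ i *s row i ?A) = (\<chi> l. M' k l)"
    proof (rule vec_eq_iff[THEN iffD2], rule allI)
      fix l
      have "(\<Sum>i\<in>UNIV. x $ i *s row i ?A) $ l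
         = (\<Sum>i\<in>UNIV. \<Sum>j\<in>UNIV. M' k j * (matrix_inv ?A $ j $ i * ?A $ i $ l))"
        by (simp add: x_def row_def sum_distrib_right mult.assoc)
      also have "\<dots> = (\<Sum>j\<in>UNIV. M' k j * (\<Sum>i\<in>UNIV. matrix_inv ?A $ j $ i * ?A $ i $ l))"
        by (subst sum.swap) (simp add: sum_distrib_left)
      also have "\<dots> = M' k l"
        by (simp add: matrix_inv_contract[OF nz] if_distrib cong: if_cong)
      finally show "(\<Sum>i\<in>UNIV. x $ i *s row i ?A) $ l = (\<chi> l. M' k l) $ l" by simp
    qed
    then have "x $ k * det ?A = det (\<chi> i. if i = k then (\<chi> l. M' k l) else row i ?A)"
      using cramer_lemma_transpose[of k x ?A] by (simp only:)
    also have "\<dots> = (\<Sum>p\<in>?P. of_int (sign p) * (M' k (p k) * (\<Prod>i\<in>UNIV - {k}. ?A $ i $ p i)))"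
      by (simp add: row)
    finally show ?thesis by (simp add: x_def mult.commute)
  qed
  have "(\<Sum>p\<in>?P. of_int (sign p) * (\<Sum>k\<in>UNIV. M' k (p k) * (\<Prod>i\<in>UNIV - {k}. ?A $ i $ p i)))
     = (\<Sum>k\<in>UNIV. \<Sum>p\<in>?P. of_int (sign p) * (M' k (p k) * (\<Prod>i\<in>UNIV - {k}. ?A $ i $ p i)))"
    by (subst sum.swap) (simp add: sum_distrib_left)
  also have "\<dots> = (\<Sum>k\<in>UNIV. \<Sum>j\<in>UNIV. matrix_inv ?A $ j $ k * M' k j) * det ?A"
    by (simp add: k sum_distrib_right)
  also have "\<dots> = det ?A * (\<Sum>i\<in>UNIV. \<Sum>j\<in>UNIV. matrix_inv ?A $ i $ j * M' j i)"
    by (subst sum.swap) simp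
  finally show ?thesis using D by simp
qed

lemma has_real_derivative_ln_det:
  fixes M :: "real \<Rightarrow> real^'k::finite^'k"
  assumes M: "\<And>i j. ((\<lambda>r. M r $ i $ j) has_real_derivative M' i j) (at t within I)"
    and pos: "det (M t) > 0"
  shows "((\<lambda>r. ln (det (M r))) has_real_derivative
           (\<Sum>i\<in>UNIV. \<Sum>j\<in>UNIV. matrix_inv (M t) $ i $ j * M' j i)) (at t within I)"
proof -
  have "((\<lambda>r. ln (det (M r))) has_real_derivative inverse (det (M t)) *
      (det (M t) * (\<Sum>i\<in>UNIV. \<Sum>j\<in>UNIV. matrix_inv (M t) $ i $ j * M' j i))) (at t within I)"
    using DERIV_chain2[OF DERIV_ln[OF pos] has_real_derivative_det[OF M]] pos by simp
  then show ?thesis using pos by (simp add: field_simps)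
qed

section \<open>Smooth families of metrics\<close>

lemma smooth_family_cong:
  assumes "\<And>p x. p \<in> P \<Longrightarrow> x \<in> B \<Longrightarrow> f p x = g p x"
  shows "smooth_family P B f \<longleftrightarrow> smooth_family P B g"
  unfolding smooth_family_def by (rule smooth_on_cong) (use assms in auto)

lemmas smooth_family_ring =
  smooth_family_add smooth_family_diff smooth_family_mult smooth_family_sum smooth_family_const

definition metric_family ::
  "'p::euclidean_space set \<Rightarrow> (real^'n) set \<Rightarrow> ('p \<Rightarrow> real^'n \<Rightarrow> real^'n^'n) \<Rightarrow> bool" where
  "metric_family P B M \<longleftrightarrow>
     open B \<and> smooth_family P B M \<and> (\<forall>p\<in>P. \<forall>x\<in>B. positive_definite (M p x))"

context
  fixes P :: "'p::euclidean_space set" and B :: "(real^'n::finite) set" and M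
  assumes M: "metric_family P B M"
begin

lemma metric_family_open: "open B"
  using M by (simp add: metric_family_def)

lemma metric_det_pos: "p \<in> P \<Longrightarrow> x \<in> B \<Longrightarrow> det (M p x) > 0"
  using M positive_definite_det_pos by (auto simp: metric_family_def)

lemma metric_det_nz: "p \<in> P \<Longrightarrow> x \<in> B \<Longrightarrow> det (M p x) \<noteq> 0"
  using metric_det_pos by fastforce

lemma metric_sym:
  assumes "p \<in> P" "x \<in> B" shows "M p x $ i $ j = M p x $ j $ i"
proof -
  have "transpose (M p x) $ i $ j = M p x $ i $ j"
    using M assms by (simp add: metric_family_def positive_definite_def)
  then show ?thesis by (simp add: transpose_def)
qed

lemma ginv_sym: "p \<in> P \<Longrightarrow> x \<in> B \<Longrightarrow> ginv (M p) i j x = ginv (M p) j i x"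
  unfolding ginv_def using M metric_det_nz
  by (intro matrix_inv_sym) (auto simp: metric_family_def positive_definite_def)

lemma ginv_contract:
  assumes "p \<in> P" "x \<in> B"
  shows "(\<Sum>k\<in>UNIV. M p x $ i $ k * ginv (M p) k j x) = (if i = j then 1 else 0)"
    and "(\<Sum>k\<in>UNIV. ginv (M p) i k x * M p x $ k $ j) = (if i = j then 1 else 0)"
  unfolding ginv_def using matrix_inv_contract[OF metric_det_nz[OF assms]] by auto

lemma smooth_metric: "smooth_family P B (\<lambda>p x. M p x $ i $ j)"
  using M by (intro smooth_family_entry) (simp add: metric_family_def)

lemma smooth_pd:
  "smooth_family P B (\<lambda>p x. f p x) \<Longrightarrow> smooth_family P B (\<lambda>p x. pd i (f p) x)"
  for f :: "'p \<Rightarrow> real^'n \<Rightarrow> real"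
  using smooth_family_pd[OF _ metric_family_open] .

lemma smooth_ginv: "smooth_family P B (\<lambda>p x. ginv (M p) i j x)"
proof -
  have "smooth_family P B (\<lambda>p x. (\<chi> a b. if b = i then if a = j then 1 else 0 else M p x $ a $ b) $ k $ l)"
    for k l
    by (cases "l = i"; cases "k = j") (simp_all add: smooth_family_const smooth_metric)
  then have "smooth_family P B
      (\<lambda>p x. det (\<chi> a b. if b = i then if a = j then 1 else 0 else M p x $ a $ b) / det (M p x))"
    by (intro smooth_family_divide smooth_family_det smooth_metric metric_det_nz)
  then show ?thesis
    by (subst smooth_family_cong) (auto simp: ginv_def matrix_inv_cramer metric_det_nz)
qed

lemma smooth_christoffel: "smooth_family P B (\<lambda>p x. christoffel (M p) k i j x)"
  unfolding christoffel_def
  by (intro smooth_family_ring smooth_family_divide smooth_ginv smooth_pd smooth_metric) auto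

lemma smooth_ric: "smooth_family P B (\<lambda>p x. ric (M p) j k x)"
  unfolding ric_def riem_def
  by (intro smooth_family_ring smooth_pd smooth_christoffel)

lemma smooth_scal: "smooth_family P B (\<lambda>p x. scal (M p) x)"
  unfolding scal_def by (intro smooth_family_ring smooth_ginv smooth_ric)

lemma smooth_ln_det: "smooth_family P B (\<lambda>p x. ln (det (M p x)))"
  by (intro smooth_family_ln smooth_family_det smooth_metric metric_det_pos)

lemma differentiable_metric:
  "p \<in> P \<Longrightarrow> x \<in> B \<Longrightarrow> (\<lambda>y. M p y $ i $ j) differentiable (at x)"
  by (rule smooth_family_differentiable[OF smooth_metric metric_family_open])

lemma differentiable_ginv:
  "p \<in> P \<Longrightarrow> x \<in> B \<Longrightarrow> ginv (M p) i j differentiable (at x)"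
  by (rule smooth_family_differentiable[OF smooth_ginv metric_family_open])

lemma pd_metric_sym:
  assumes "p \<in> P" "x \<in> B" shows "pd k (\<lambda>y. M p y $ i $ j) x = pd k (\<lambda>y. M p y $ j $ i) x"
  using metric_sym[OF assms(1)] by (intro pd_cong[OF metric_family_open assms(2)])

lemma christoffel_sym:
  assumes "p \<in> P" "x \<in> B" shows "christoffel (M p) k i j x = christoffel (M p) k j i x"
  unfolding christoffel_def by (simp add: pd_metric_sym[OF assms, of _ i j] add.commute)

lemma lower_raise:
  assumes "p \<in> P" "x \<in> B"
  shows "(\<Sum>k\<in>UNIV. M p x $ l $ k * (\<Sum>c\<in>UNIV. ginv (M p) k c x * v c)) = v l"
    and "(\<Sum>k\<in>UNIV. ginv (M p) l k x * (\<Sum>c\<in>UNIV. M p x $ k $ c * v c)) = v l"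
proof -
  have "(\<Sum>k\<in>UNIV. M p x $ l $ k * (\<Sum>c\<in>UNIV. ginv (M p) k c x * v c))
      = (\<Sum>c\<in>UNIV. (\<Sum>k\<in>UNIV. M p x $ l $ k * ginv (M p) k c x) * v c)"
    by (simp add: sum_distrib_left sum_distrib_right mult.assoc) (rule sum.swap)
  then show "(\<Sum>k\<in>UNIV. M p x $ l $ k * (\<Sum>c\<in>UNIV. ginv (M p) k c x * v c)) = v l"
    by (simp add: ginv_contract[OF assms] if_distrib[of "\<lambda>z. z * _"] cong: if_cong)
  have "(\<Sum>k\<in>UNIV. ginv (M p) l k x * (\<Sum>c\<in>UNIV. M p x $ k $ c * v c))
      = (\<Sum>c\<in>UNIV. (\<Sum>k\<in>UNIV. ginv (M p) l k x * M p x $ k $ c) * v c)"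
    by (simp add: sum_distrib_left sum_distrib_right mult.assoc) (rule sum.swap)
  then show "(\<Sum>k\<in>UNIV. ginv (M p) l k x * (\<Sum>c\<in>UNIV. M p x $ k $ c * v c)) = v l"
    by (simp add: ginv_contract[OF assms] if_distrib[of "\<lambda>z. z * _"] cong: if_cong)
qed

lemma christoffel_lower:
  assumes "p \<in> P" "x \<in> B"
  shows "(\<Sum>k\<in>UNIV. M p x $ l $ k * christoffel (M p) k i j x) =
    (pd i (\<lambda>y. M p y $ j $ l) x + pd j (\<lambda>y. M p y $ i $ l) x - pd l (\<lambda>y. M p y $ i $ j) x) / 2"
  using lower_raise(1)[OF assms, of l
      "\<lambda>l. pd i (\<lambda>y. M p y $ j $ l) x + pd j (\<lambda>y. M p y $ i $ l) x - pd l (\<lambda>y. M p y $ i $ j) x"]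
  by (simp add: christoffel_def sum_divide_distrib[symmetric])

text \<open>This is \<open>\<nabla> g = 0\<close> in coordinates: in the sum of the two lowered
  Christoffel symbols four of the six derivatives cancel.\<close>

lemma pd_metric:
  assumes "p \<in> P" "x \<in> B"
  shows "pd k (\<lambda>y. M p y $ i $ j) x =
    (\<Sum>q\<in>UNIV. M p x $ j $ q * christoffel (M p) q k i x) + (\<Sum>q\<in>UNIV. M p x $ i $ q * christoffel (M p) q k j x)"
  unfolding christoffel_lower[OF assms]
  using pd_metric_sym[OF assms, of k i j] pd_metric_sym[OF assms, of i k j] pd_metric_sym[OF assms, of j k i]
  by (simp add: field_simps)

end

section \<open>Smoothness of the DeTurck terms and derivatives of the inverse metric\<close>

lemma smooth_W_up:
  assumes M: "metric_family P B M" and M0: "metric_family P B M0"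
  shows "smooth_family P B (\<lambda>p x. W_up (M p) (M0 p) k x)"
  unfolding W_up_def
  by (intro smooth_family_ring smooth_ginv[OF M] smooth_christoffel[OF M] smooth_christoffel[OF M0])

lemma smooth_W_low:
  assumes M: "metric_family P B M" and M0: "metric_family P B M0"
  shows "smooth_family P B (\<lambda>p x. W_low (M p) (M0 p) k x)"
  unfolding W_low_def
  by (intro smooth_family_ring smooth_metric[OF M] smooth_W_up[OF M M0])

lemma smooth_W_norm2:
  assumes M: "metric_family P B M" and M0: "metric_family P B M0"
  shows "smooth_family P B (\<lambda>p x. W_norm2 (M p) (M0 p) x)"
  unfolding W_norm2_def
  by (intro smooth_family_ring smooth_metric[OF M] smooth_W_up[OF M M0])

lemma smooth_cov1_W_low:
  assumes M: "metric_family P B M" and M0: "metric_family P B M0"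
  shows "smooth_family P B (\<lambda>p x. cov1 (M p) (W_low (M p) (M0 p)) i j x)"
  unfolding cov1_def
  by (intro smooth_family_ring smooth_pd[OF M] smooth_christoffel[OF M] smooth_W_low[OF M M0])

text \<open>Differentiates \<open>N M = 1\<close>.\<close>

lemma inverse_derivative:
  fixes N N' M M' :: "'n::finite \<Rightarrow> 'n \<Rightarrow> real"
  assumes "\<And>i j. (\<Sum>k\<in>UNIV. N i k * M' k j + N' i k * M k j) = 0"
    and "\<And>i j. (\<Sum>k\<in>UNIV. M i k * N k j) = (if i = j then 1 else 0)"
  shows "N' i j = - (\<Sum>a\<in>UNIV. \<Sum>b\<in>UNIV. N i a * M' a b * N b j)"
proof -
  have "N' i j = (\<Sum>k\<in>UNIV. N' i k * (\<Sum>l\<in>UNIV. M k l * N l j))"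
    by (simp add: assms(2) if_distrib cong: if_cong)
  also have "\<dots> = (\<Sum>l\<in>UNIV. (\<Sum>k\<in>UNIV. N' i k * M k l) * N l j)"
    by (simp add: sum_distrib_left sum_distrib_right mult.assoc) (rule sum.swap)
  also have "\<dots> = (\<Sum>l\<in>UNIV. - (\<Sum>k\<in>UNIV. N i k * M' k l) * N l j)"
    using assms(1) by (intro sum.cong refl arg_cong2[of _ _ _ _ "(*)"]) (simp add: sum.distrib eq_neg_iff_add_eq_0 add.commute)
  also have "\<dots> = - (\<Sum>l\<in>UNIV. \<Sum>k\<in>UNIV. N i k * M' k l * N l j)"
    by (simp add: sum_negf sum_distrib_right)
  also have "\<dots> = - (\<Sum>a\<in>UNIV. \<Sum>b\<in>UNIV. N i a * M' a b * N b j)"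
    by (subst sum.swap) (rule refl)
  finally show ?thesis .
qed

text \<open>\<open>M'\<close> and \<open>N'\<close> are arbitrary arrays because the rule is applied
  to derivatives along a coordinate as well as to derivatives along \<open>s\<close>.\<close>

lemma ginv_derivative_aux:
  assumes M: "metric_family P B M" "p \<in> P" "x \<in> B"
    and "\<And>i j. (\<Sum>k\<in>UNIV. ginv (M p) i k x * M' k j + N' i k * M p x $ k $ j) = 0"
  shows "N' i j = - (\<Sum>a\<in>UNIV. \<Sum>b\<in>UNIV. ginv (M p) i a x * M' a b * ginv (M p) b j x)"
  using assms(4) by (rule inverse_derivative) (rule ginv_contract[OF M])

text \<open>This is \<open>\<nabla> g^-1 = 0\<close>. In \<open>- g^-1 (dg) g^-1\<close> the metric
  derivative splits by \<open>pd_metric\<close> into two lowered Christoffel symbols, and one of the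
  two inverse factors raises each of them again.\<close>

lemma pd_ginv:
  assumes M: "metric_family P B M" and p: "p \<in> P" and x: "x \<in> B"
  shows "pd k (ginv (M p) i j) x = - (\<Sum>q\<in>UNIV. christoffel (M p) i k q x * ginv (M p) q j x)
     - (\<Sum>q\<in>UNIV. christoffel (M p) j k q x * ginv (M p) q i x)"
proof -
  let ?I = "\<lambda>i j. ginv (M p) i j x" and ?m = "\<lambda>i j. M p x $ i $ j" and ?\<Gamma> = "\<lambda>k i j. christoffel (M p) k i j x"
  let ?dm = "\<lambda>i j. pd k (\<lambda>y. M p y $ i $ j) x"
  have "pd k (\<lambda>y. \<Sum>c\<in>UNIV. ginv (M p) i c y * M p y $ c $ j) x = pd k (\<lambda>_. if i = j then 1 else 0) x" for i j
    by (rule pd_cong[OF metric_family_open[OF M] x]) (simp add: ginv_contract[OF M p])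
  then have "(\<Sum>c\<in>UNIV. ?I i c * ?dm c j + pd k (ginv (M p) i c) x * ?m c j) = 0" for i j
    by (simp add: pd_sum pd_mult pd_const differentiable_ginv[OF M p x] differentiable_metric[OF M p x] differentiable_mult)
  then have "pd k (ginv (M p) i j) x = - (\<Sum>a\<in>UNIV. \<Sum>b\<in>UNIV. ?I i a * ?dm a b * ?I b j)"
    by (rule ginv_derivative_aux[OF M p x])
  also have "(\<Sum>a\<in>UNIV. \<Sum>b\<in>UNIV. ?I i a * ?dm a b * ?I b j)
     = (\<Sum>a\<in>UNIV. ?I i a * (\<Sum>b\<in>UNIV. ?I j b * (\<Sum>q\<in>UNIV. ?m b q * ?\<Gamma> q k a)))
     + (\<Sum>b\<in>UNIV. ?I b j * (\<Sum>a\<in>UNIV. ?I i a * (\<Sum>q\<in>UNIV. ?m a q * ?\<Gamma> q k b)))"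
  proof -
    have "(\<Sum>a\<in>UNIV. \<Sum>b\<in>UNIV. ?I i a * ?dm a b * ?I b j)
     = (\<Sum>a\<in>UNIV. \<Sum>b\<in>UNIV. ?I i a * (?I j b * (\<Sum>q\<in>UNIV. ?m b q * ?\<Gamma> q k a)))
     + (\<Sum>a\<in>UNIV. \<Sum>b\<in>UNIV. ?I b j * (?I i a * (\<Sum>q\<in>UNIV. ?m a q * ?\<Gamma> q k b)))"
    proof -
      define X where "X a b = (\<Sum>q\<in>UNIV. ?m b q * ?\<Gamma> q k a)" for a b
      have "?dm a b = X a b + X b a" for a b by (simp add: pd_metric[OF M p x] X_def)
      then show ?thesis
        unfolding X_def[symmetric]
        by (simp add: sum.distrib[symmetric] algebra_simps ginv_sym[OF M p x, of j])
    qed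
    also have "(\<Sum>a\<in>UNIV. \<Sum>b\<in>UNIV. ?I b j * (?I i a * (\<Sum>q\<in>UNIV. ?m a q * ?\<Gamma> q k b)))
      = (\<Sum>b\<in>UNIV. \<Sum>a\<in>UNIV. ?I b j * (?I i a * (\<Sum>q\<in>UNIV. ?m a q * ?\<Gamma> q k b)))"
      by (rule sum.swap)
    finally show ?thesis by (simp add: sum_distrib_left)
  qed
  also have "\<dots> = (\<Sum>q\<in>UNIV. ?\<Gamma> j k q * ?I q i) + (\<Sum>q\<in>UNIV. ?\<Gamma> i k q * ?I q j)"
    unfolding lower_raise(2)[OF M p x] by (simp add: ginv_sym[OF M p x, of i] mult.commute)
  finally show ?thesis by simp
qed

text \<open>By symmetry of the inverse metric two of the three traced derivatives cancel, and
  Jacobi's formula recognises the third. Differentiated in \<open>s\<close>, this identifies the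
  trace of \<open>A\<close> with \<open>a\<close>.\<close>

lemma christoffel_trace:
  assumes M: "metric_family P B M" and p: "p \<in> P" and x: "x \<in> B"
  shows "(\<Sum>q\<in>UNIV. christoffel (M p) q q k x) = pd k (\<lambda>y. ln (det (M p y))) x / 2"
proof -
  let ?I = "\<lambda>i j. ginv (M p) i j x" and ?dm = "\<lambda>k i j. pd k (\<lambda>y. M p y $ i $ j) x"
  have "((\<lambda>r. ln (det (M p (x + r *\<^sub>R axis k 1)))) has_real_derivative
      (\<Sum>i\<in>UNIV. \<Sum>j\<in>UNIV. matrix_inv (M p (x + 0 *\<^sub>R axis k 1)) $ i $ j * ?dm k j i)) (at 0)"
    by (rule has_real_derivative_ln_det) (use metric_det_pos[OF M p x] in \<open>auto intro: has_pd differentiable_metric[OF M p x]\<close>)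
  then have 1: "pd k (\<lambda>y. ln (det (M p y))) x = (\<Sum>i\<in>UNIV. \<Sum>j\<in>UNIV. ?I i j * ?dm k j i)"
    by (simp add: pd_def DERIV_imp_deriv ginv_def)
  have "2 * (\<Sum>q\<in>UNIV. christoffel (M p) q q k x) =
      (\<Sum>q\<in>UNIV. \<Sum>l\<in>UNIV. ?I q l * ?dm q k l) + (\<Sum>q\<in>UNIV. \<Sum>l\<in>UNIV. ?I q l * ?dm k q l)
       - (\<Sum>q\<in>UNIV. \<Sum>l\<in>UNIV. ?I q l * ?dm l q k)"
    unfolding christoffel_def sum_divide_distrib[symmetric]
    by (simp add: sum.distrib sum_subtractf field_simps)
  also have "(\<Sum>q\<in>UNIV. \<Sum>l\<in>UNIV. ?I q l * ?dm l q k) = (\<Sum>q\<in>UNIV. \<Sum>l\<in>UNIV. ?I q l * ?dm q k l)"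
    by (subst sum.swap) (simp add: ginv_sym[OF M p x] pd_metric_sym[OF M p x, of _ _ k])
  also have "(\<Sum>q\<in>UNIV. \<Sum>l\<in>UNIV. ?I q l * ?dm k q l) = pd k (\<lambda>y. ln (det (M p y))) x"
    unfolding 1 by (simp add: pd_metric_sym[OF M p x, of k])
  finally show ?thesis by simp
qed

section \<open>First variation of curvature\<close>

text \<open>With a single sum over tuples, any renaming or permutation of summation indices becomes
  one bijection for \<open>sum.reindex_bij_witness\<close>.\<close>

lemma sum_UNIV3:
  fixes f :: "'a::finite \<Rightarrow> 'b::finite \<Rightarrow> 'c::finite \<Rightarrow> 'r::comm_monoid_add"
  shows "(\<Sum>a\<in>UNIV. \<Sum>b\<in>UNIV. \<Sum>c\<in>UNIV. f a b c)
    = (\<Sum>z\<in>UNIV. f (fst z) (fst (snd z)) (snd (snd z)))"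
  by (simp add: sum.cartesian_product UNIV_Times_UNIV[symmetric] case_prod_unfold del: UNIV_Times_UNIV)

lemma sum_UNIV4:
  fixes f :: "'a::finite \<Rightarrow> 'b::finite \<Rightarrow> 'c::finite \<Rightarrow> 'd::finite \<Rightarrow> 'r::comm_monoid_add"
  shows "(\<Sum>a\<in>UNIV. \<Sum>b\<in>UNIV. \<Sum>c\<in>UNIV. \<Sum>d\<in>UNIV. f a b c d)
    = (\<Sum>z\<in>UNIV. f (fst z) (fst (snd z)) (fst (snd (snd z))) (snd (snd (snd z))))"
  by (simp add: sum.cartesian_product UNIV_Times_UNIV[symmetric] case_prod_unfold del: UNIV_Times_UNIV)

lemma metric_family_reparam:
  fixes L :: "'p::euclidean_space \<Rightarrow> 'q::euclidean_space"
  assumes "metric_family P' B M" "\<And>p. (L has_derivative D) (at p)" "L ` P \<subseteq> P'"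
  shows "metric_family P B (\<lambda>p. M (L p))"
  using assms smooth_family_reparam[of P' B M L D P] by (auto simp: metric_family_def)

text \<open>The coordinate formula for the divergence of a vector field, stated for the lowered
  field because \<open>W\<close> enters the flow with a lower index. \<open>pd_metric\<close>
  cancels the Christoffel term of \<open>cov1\<close>, and raising the index leaves the right-hand
  side.\<close>

lemma divergence_lowered:
  assumes M: "metric_family P B M" and p: "p \<in> P" and x: "x \<in> B"
    and V: "\<And>k. V k differentiable (at x)"
  shows "(\<Sum>i\<in>UNIV. \<Sum>j\<in>UNIV. ginv (M p) i j x * cov1 (M p) (\<lambda>j y. \<Sum>k\<in>UNIV. M p y $ j $ k * V k y) i j x)
    = (\<Sum>i\<in>UNIV. pd i (V i) x) + (\<Sum>k\<in>UNIV. V k x * (\<Sum>i\<in>UNIV. christoffel (M p) i i k x))"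
proof -
  let ?I = "\<lambda>i j. ginv (M p) i j x" and ?m = "\<lambda>i j. M p x $ i $ j" and ?\<Gamma> = "\<lambda>k i j. christoffel (M p) k i j x"
  let ?w = "\<lambda>j. \<Sum>k\<in>UNIV. ?m j k * V k x"
  have 1: "(\<Sum>k\<in>UNIV. (\<Sum>q\<in>UNIV. ?m k q * ?\<Gamma> q i j) * V k x) = (\<Sum>q\<in>UNIV. ?\<Gamma> q i j * ?w q)" for i j
    by (simp add: sum_distrib_left sum_distrib_right) 
      (subst sum.swap, intro sum.cong refl, simp add: metric_sym[OF M p x] mult_ac)
  have "cov1 (M p) (\<lambda>j y. \<Sum>k\<in>UNIV. M p y $ j $ k * V k y) i j x
     = (\<Sum>k\<in>UNIV. ?m j k * pd i (V k) x) + (\<Sum>k\<in>UNIV. V k x * (\<Sum>q\<in>UNIV. ?m j q * ?\<Gamma> q i k))" for i j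
  proof -
    have "pd i (\<lambda>y. \<Sum>k\<in>UNIV. M p y $ j $ k * V k y) x
       = (\<Sum>k\<in>UNIV. ?m j k * pd i (V k) x) + (\<Sum>k\<in>UNIV. pd i (\<lambda>y. M p y $ j $ k) x * V k x)"
      by (simp add: pd_sum pd_mult V differentiable_metric[OF M p x] differentiable_mult sum.distrib)
    also have "(\<Sum>k\<in>UNIV. pd i (\<lambda>y. M p y $ j $ k) x * V k x) = (\<Sum>q\<in>UNIV. ?\<Gamma> q i j * ?w q)
       + (\<Sum>k\<in>UNIV. V k x * (\<Sum>q\<in>UNIV. ?m j q * ?\<Gamma> q i k))"
      unfolding 1[symmetric] by (simp add: pd_metric[OF M p x] distrib_right distrib_left sum.distrib mult.commute)
    finally show ?thesis
      unfolding cov1_def by simp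
  qed
  moreover have "(\<Sum>j\<in>UNIV. ?I i j * (\<Sum>k\<in>UNIV. V k x * (\<Sum>q\<in>UNIV. ?m j q * ?\<Gamma> q i k)))
     = (\<Sum>k\<in>UNIV. V k x * (\<Sum>j\<in>UNIV. ?I i j * (\<Sum>q\<in>UNIV. ?m j q * ?\<Gamma> q i k)))" for i
    unfolding sum_distrib_left by (subst sum.swap) (simp add: mult_ac)
  ultimately have "(\<Sum>j\<in>UNIV. ?I i j * cov1 (M p) (\<lambda>j y. \<Sum>k\<in>UNIV. M p y $ j $ k * V k y) i j x)
     = pd i (V i) x + (\<Sum>k\<in>UNIV. V k x * ?\<Gamma> i i k)" for i
    by (simp add: distrib_left sum.distrib lower_raise(2)[OF M p x])
  then show ?thesis
    by (simp add: sum.distrib sum_distrib_left) (rule sum.swap)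
qed

section \<open>Variation at \<open>s = 0\<close> in one chart, with the time fixed\<close>

context
  fixes \<sigma> :: real and B :: "(real^'n::finite) set" and M :: "real \<Rightarrow> real^'n \<Rightarrow> real^'n^'n"
    and h :: "real^'n \<Rightarrow> real^'n^'n"
  assumes \<sigma>: "0 < \<sigma>" and M: "metric_family {-\<sigma><..<\<sigma>} B M"
    and h: "\<And>y i j. y \<in> B \<Longrightarrow> ((\<lambda>s. M s y $ i $ j) has_real_derivative h y $ i $ j) (at 0)"
begin

lemma zero_in_interval: "0 \<in> {-\<sigma><..<\<sigma>}" using \<sigma> by simp

lemma constant_family: "metric_family {-\<sigma><..<\<sigma>} B (\<lambda>_. M 0)"
  by (rule metric_family_reparam[OF M, of "\<lambda>_. 0" "\<lambda>_. 0"]) (use zero_in_interval in \<open>auto intro!: derivative_eq_intros\<close>)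

lemmas base_deriv = smooth_family_has_deriv[OF _ open_greaterThanLessThan metric_family_open[OF M] zero_in_interval]
  and base_deriv_differentiable = smooth_family_deriv_differentiable[OF _ open_greaterThanLessThan metric_family_open[OF M] zero_in_interval]
  and base_deriv_pd = smooth_family_deriv_pd[OF _ open_greaterThanLessThan metric_family_open[OF M] zero_in_interval]

text \<open>Differentiates an identity valid for every \<open>s\<close> of the interval. Several of
  the linearised formulas below arise in this way from identities for \<open>M s\<close>.\<close>

lemma deriv_unique_on_interval:
  assumes "(f has_real_derivative a) (at 0)" "(g has_real_derivative b) (at 0)"
    "\<And>s. s \<in> {-\<sigma><..<\<sigma>} \<Longrightarrow> f s = g s"
  shows "a = b"
  using has_field_derivative_transform_within_open[OF assms(1) open_greaterThanLessThan zero_in_interval assms(3)]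
    assms(2) DERIV_unique by blast

lemma deriv_metric: "y \<in> B \<Longrightarrow> deriv (\<lambda>s. M s y $ i $ j) 0 = h y $ i $ j"
  using h DERIV_imp_deriv by blast

lemma differentiable_variation: "x \<in> B \<Longrightarrow> (\<lambda>y. h y $ i $ j) differentiable (at x)"
proof -
  assume x: "x \<in> B"
  then obtain D where D: "((\<lambda>y. deriv (\<lambda>s. M s y $ i $ j) 0) has_derivative D) (at x)"
    using base_deriv_differentiable[OF smooth_metric[OF M], of x i j] unfolding differentiable_def by blast
  have "((\<lambda>y. h y $ i $ j) has_derivative D) (at x)"
    by (rule has_derivative_transform_within_open[OF D metric_family_open[OF M] x]) (rule deriv_metric)
  then show ?thesis by (rule differentiableI)
qed

lemma pd_metric_deriv:
  assumes "x \<in> B"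
  shows "((\<lambda>s. pd k (\<lambda>y. M s y $ i $ j) x) has_real_derivative pd k (\<lambda>y. h y $ i $ j) x) (at 0)"
  using base_deriv_pd[OF smooth_metric[OF M] assms, of k i j]
    pd_cong[OF metric_family_open[OF M] assms, of "\<lambda>y. deriv (\<lambda>s. M s y $ i $ j) 0" "\<lambda>y. h y $ i $ j" k] deriv_metric
  by simp

lemma variation_sym: 
  assumes "x \<in> B" shows "h x $ i $ j = h x $ j $ i"
  by (rule deriv_unique_on_interval[OF h[OF assms] h[OF assms]]) (rule metric_sym[OF M _ assms])

text \<open>The \<open>A\<close> of the overview. It is not solved for with its upper index; the
  proof computes its lowered form and its trace.\<close>

definition christoffel_var where "christoffel_var k i j y = deriv (\<lambda>s. christoffel (M s) k i j y) 0"

lemma christoffel_var_deriv: "x \<in> B \<Longrightarrow> ((\<lambda>s. christoffel (M s) k i j x) has_real_derivative christoffel_var k i j x) (at 0)"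
  unfolding christoffel_var_def using base_deriv[OF smooth_christoffel[OF M]] .

lemma christoffel_var_differentiable: "x \<in> B \<Longrightarrow> christoffel_var k i j differentiable (at x)"
  using base_deriv_differentiable[OF smooth_christoffel[OF M]] by (simp add: christoffel_var_def[abs_def])

lemma pd_christoffel_var: "x \<in> B \<Longrightarrow> ((\<lambda>s. pd l (christoffel (M s) k i j) x) has_real_derivative pd l (christoffel_var k i j) x) (at 0)"
  using base_deriv_pd[OF smooth_christoffel[OF M]] by (simp add: christoffel_var_def[abs_def])

lemma christoffel_var_sym: "x \<in> B \<Longrightarrow> christoffel_var k i j x = christoffel_var k j i x"
  by (rule deriv_unique_on_interval[OF christoffel_var_deriv christoffel_var_deriv]) (auto intro: christoffel_sym[OF M])

lemma ginv_deriv: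
  assumes x: "x \<in> B"
  shows "((\<lambda>s. ginv (M s) i j x) has_real_derivative
    - (\<Sum>a\<in>UNIV. \<Sum>b\<in>UNIV. ginv (M 0) i a x * h x $ a $ b * ginv (M 0) b j x)) (at 0)"
proof -
  let ?N' = "\<lambda>i j. deriv (\<lambda>s. ginv (M s) i j x) 0"
  have d: "((\<lambda>s. ginv (M s) i j x) has_real_derivative ?N' i j) (at 0)" for i j
    by (rule base_deriv[OF smooth_ginv[OF M] x])
  have "(\<Sum>k\<in>UNIV. ginv (M 0) i k x * h x $ k $ j + ?N' i k * M 0 x $ k $ j) = 0" for i j
  proof (rule deriv_unique_on_interval)
    show "((\<lambda>s. \<Sum>k\<in>UNIV. ginv (M s) i k x * M s x $ k $ j) has_real_derivative
        (\<Sum>k\<in>UNIV. ginv (M 0) i k x * h x $ k $ j + ?N' i k * M 0 x $ k $ j)) (at 0)"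
      by (auto intro!: derivative_eq_intros d h[OF x] sum.cong)
    show "((\<lambda>s. if i = j then 1 else 0) has_real_derivative 0) (at 0)" by simp
  qed (simp add: ginv_contract[OF M _ x])
  then have "?N' i j = - (\<Sum>a\<in>UNIV. \<Sum>b\<in>UNIV. ginv (M 0) i a x * h x $ a $ b * ginv (M 0) b j x)"
    by (rule ginv_derivative_aux[OF M zero_in_interval x])
  with d[of i j] show ?thesis by simp
qed

text \<open>Differentiating the lowered symbols instead of the definition of
  \<open>christoffel\<close> avoids the derivative of the inverse metric; the price is the product
  of \<open>h\<close> with the Christoffel symbols.\<close>

lemma christoffel_var_lower:
  assumes x: "x \<in> B"
  shows "(\<Sum>k\<in>UNIV. M 0 x $ l $ k * christoffel_var k i j x) =
    (pd i (\<lambda>y. h y $ j $ l) x + pd j (\<lambda>y. h y $ i $ l) x - pd l (\<lambda>y. h y $ i $ j) x) / 2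
     - (\<Sum>k\<in>UNIV. h x $ l $ k * christoffel (M 0) k i j x)"
proof -
  have "(\<Sum>k\<in>UNIV. M 0 x $ l $ k * christoffel_var k i j x + h x $ l $ k * christoffel (M 0) k i j x) =
    (pd i (\<lambda>y. h y $ j $ l) x + pd j (\<lambda>y. h y $ i $ l) x - pd l (\<lambda>y. h y $ i $ j) x) / 2"
  proof (rule deriv_unique_on_interval)
    show "((\<lambda>s. \<Sum>k\<in>UNIV. M s x $ l $ k * christoffel (M s) k i j x) has_real_derivative
        (\<Sum>k\<in>UNIV. M 0 x $ l $ k * christoffel_var k i j x + h x $ l $ k * christoffel (M 0) k i j x)) (at 0)"
      by (auto intro!: derivative_eq_intros h[OF x] christoffel_var_deriv[OF x] sum.cong)
    show "((\<lambda>s. (pd i (\<lambda>y. M s y $ j $ l) x + pd j (\<lambda>y. M s y $ i $ l) x - pd l (\<lambda>y. M s y $ i $ j) x) / 2)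
      has_real_derivative (pd i (\<lambda>y. h y $ j $ l) x + pd j (\<lambda>y. h y $ i $ l) x - pd l (\<lambda>y. h y $ i $ j) x) / 2) (at 0)"
      by (auto intro!: derivative_eq_intros pd_metric_deriv[OF x])
  qed (rule christoffel_lower[OF M _ x])
  then show ?thesis unfolding sum.distrib by linarith
qed

lemma W_up_zero: "W_up (M 0) (M 0) k x = 0"
  by (simp add: W_up_def)

text \<open>At \<open>s = 0\<close> the difference of the Christoffel symbols vanishes, so the
  derivative of the inverse metric in front of it drops out.\<close>

lemma W_up_deriv:
  assumes x: "x \<in> B"
  shows "((\<lambda>s. W_up (M s) (M 0) k x) has_real_derivative
    (\<Sum>i\<in>UNIV. \<Sum>j\<in>UNIV. ginv (M 0) i j x * christoffel_var k i j x)) (at 0)"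
  unfolding W_up_def
  by (auto intro!: derivative_eq_intros ginv_deriv[OF x] christoffel_var_deriv[OF x] sum.cong)

text \<open>The \<open>w\<close> of the overview, with lowered index.\<close>

definition W_var where "W_var j y = deriv (\<lambda>s. W_low (M s) (M 0) j y) 0"

lemma W_low_deriv: "x \<in> B \<Longrightarrow> ((\<lambda>s. W_low (M s) (M 0) j x) has_real_derivative W_var j x) (at 0)"
  unfolding W_var_def using base_deriv[OF smooth_W_low[OF M constant_family]] .

lemma W_var_differentiable: "x \<in> B \<Longrightarrow> W_var j differentiable (at x)"
  using base_deriv_differentiable[OF smooth_W_low[OF M constant_family]] by (simp add: W_var_def[abs_def])

lemma pd_W_var: "x \<in> B \<Longrightarrow> ((\<lambda>s. pd l (W_low (M s) (M 0) j) x) has_real_derivative pd l (W_var j) x) (at 0)"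
  using base_deriv_pd[OF smooth_W_low[OF M constant_family]] by (simp add: W_var_def[abs_def])

lemma W_var_eq:
  assumes x: "x \<in> B"
  shows "W_var j x = (\<Sum>k\<in>UNIV. M 0 x $ j $ k * (\<Sum>a\<in>UNIV. \<Sum>b\<in>UNIV. ginv (M 0) a b x * christoffel_var k a b x))"
proof (rule DERIV_unique[OF W_low_deriv[OF x]])
  show "((\<lambda>s. W_low (M s) (M 0) j x) has_real_derivative
     (\<Sum>k\<in>UNIV. M 0 x $ j $ k * (\<Sum>a\<in>UNIV. \<Sum>b\<in>UNIV. ginv (M 0) a b x * christoffel_var k a b x))) (at 0)"
    unfolding W_low_def
    by (auto intro!: derivative_eq_intros h[OF x] W_up_deriv[OF x] sum.cong simp: W_up_zero)
qed

text \<open>By Jacobi's formula this is the trace of \<open>h\<close>, see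
  \<open>ln_det_var_eq\<close>; half its gradient is the \<open>a\<close> of the overview.\<close>

definition ln_det_var where "ln_det_var y = deriv (\<lambda>s. ln (det (M s y))) 0"

lemma ln_det_deriv: "x \<in> B \<Longrightarrow> ((\<lambda>s. ln (det (M s x))) has_real_derivative ln_det_var x) (at 0)"
  unfolding ln_det_var_def using base_deriv[OF smooth_ln_det[OF M]] .

lemma pd_ln_det_var: "x \<in> B \<Longrightarrow> ((\<lambda>s. pd l (\<lambda>y. ln (det (M s y))) x) has_real_derivative pd l ln_det_var x) (at 0)"
  using base_deriv_pd[OF smooth_ln_det[OF M]] by (simp add: ln_det_var_def[abs_def])

lemma ln_det_var_eq:
  assumes x: "x \<in> B" shows "ln_det_var x = (\<Sum>i\<in>UNIV. \<Sum>j\<in>UNIV. ginv (M 0) i j x * h x $ j $ i)"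
  using DERIV_unique[OF ln_det_deriv[OF x] has_real_derivative_ln_det[OF h[OF x] metric_det_pos[OF M zero_in_interval x]]]
  by (simp add: ginv_def)

lemma christoffel_var_trace:
  assumes x: "x \<in> B" shows "(\<Sum>p\<in>UNIV. christoffel_var p p k x) = pd k ln_det_var x / 2"
proof (rule deriv_unique_on_interval)
  show "((\<lambda>s. \<Sum>p\<in>UNIV. christoffel (M s) p p k x) has_real_derivative (\<Sum>p\<in>UNIV. christoffel_var p p k x)) (at 0)"
    by (intro DERIV_sum christoffel_var_deriv x)
  show "((\<lambda>s. pd k (\<lambda>y. ln (det (M s y))) x / 2) has_real_derivative pd k ln_det_var x / 2) (at 0)"
    by (intro DERIV_cdivide pd_ln_det_var x)
qed (rule christoffel_trace[OF M _ x])

text \<open>In the trace of \<open>christoffel_var_lower\<close> two derivative terms coincide and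
  give the leading part of \<open>div h\<close>. The third is cancelled by the part of the gradient
  of the trace in which \<open>h\<close> is differentiated. The derivative of the inverse metric
  supplies one Christoffel term of \<open>cov2\<close>, and the correction in
  \<open>christoffel_var_lower\<close> the other.\<close>

lemma W_var_plus_trace:
  assumes x: "x \<in> B"
  shows "W_var l x + pd l ln_det_var x / 2 = div2 (M 0) h l x"
proof -
  let ?I = "\<lambda>i j. ginv (M 0) i j x" and ?h = "\<lambda>i j. h x $ i $ j" and ?\<Gamma> = "\<lambda>k i j. christoffel (M 0) k i j x"
  let ?dh = "\<lambda>k i j. pd k (\<lambda>y. h y $ i $ j) x"
  note Is = ginv_sym[OF M zero_in_interval x] and Gs = christoffel_sym[OF M zero_in_interval x]
  have "W_var l x = (\<Sum>a\<in>UNIV. \<Sum>b\<in>UNIV. ?I a b * (\<Sum>k\<in>UNIV. M 0 x $ l $ k * christoffel_var k a b x))"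
    unfolding W_var_eq[OF x] sum_distrib_left sum_UNIV3
    by (rule sum.reindex_bij_witness[of _ "\<lambda>(a, b, k). (k, a, b)" "\<lambda>(k, a, b). (a, b, k)"]) auto
  also have "\<dots> = (\<Sum>a\<in>UNIV. \<Sum>b\<in>UNIV. ?I a b * (?dh a b l / 2)) + (\<Sum>a\<in>UNIV. \<Sum>b\<in>UNIV. ?I a b * (?dh b a l / 2))
      - (\<Sum>a\<in>UNIV. \<Sum>b\<in>UNIV. ?I a b * ?dh l a b) / 2 - (\<Sum>a\<in>UNIV. \<Sum>b\<in>UNIV. ?I a b * (\<Sum>k\<in>UNIV. ?h l k * ?\<Gamma> k a b))"
    unfolding christoffel_var_lower[OF x]
    by (simp add: algebra_simps add_divide_distrib diff_divide_distrib sum.distrib sum_subtractf sum_divide_distrib)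
  also have "(\<Sum>a\<in>UNIV. \<Sum>b\<in>UNIV. ?I a b * (?dh b a l / 2)) = (\<Sum>a\<in>UNIV. \<Sum>b\<in>UNIV. ?I a b * (?dh a b l / 2))"
    by (subst sum.swap) (simp add: Is)
  finally have W_var: "W_var l x = (\<Sum>a\<in>UNIV. \<Sum>b\<in>UNIV. ?I a b * ?dh a b l)
      - (\<Sum>a\<in>UNIV. \<Sum>b\<in>UNIV. ?I a b * ?dh l a b) / 2 - (\<Sum>a\<in>UNIV. \<Sum>b\<in>UNIV. ?I a b * (\<Sum>k\<in>UNIV. ?h l k * ?\<Gamma> k a b))"
    by (simp add: sum_divide_distrib[symmetric])
  have "pd l ln_det_var x = pd l (\<lambda>y. \<Sum>i\<in>UNIV. \<Sum>j\<in>UNIV. ginv (M 0) i j y * h y $ j $ i) x"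
    by (rule pd_cong[OF metric_family_open[OF M] x ln_det_var_eq])
  also have "\<dots> = (\<Sum>i\<in>UNIV. \<Sum>j\<in>UNIV. ?I i j * ?dh l j i) + (\<Sum>i\<in>UNIV. \<Sum>j\<in>UNIV. pd l (ginv (M 0) i j) x * ?h j i)"
    by (simp add: pd_sum pd_mult differentiable_sum differentiable_mult differentiable_ginv[OF M zero_in_interval x]
        differentiable_variation[OF x] sum.distrib)
  also have "(\<Sum>i\<in>UNIV. \<Sum>j\<in>UNIV. pd l (ginv (M 0) i j) x * ?h j i)
      = - (\<Sum>i\<in>UNIV. \<Sum>j\<in>UNIV. \<Sum>q\<in>UNIV. ?h i j * ?\<Gamma> i l q * ?I q j)
        - (\<Sum>i\<in>UNIV. \<Sum>j\<in>UNIV. \<Sum>q\<in>UNIV. ?h j i * ?\<Gamma> j l q * ?I q i)"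
    unfolding pd_ginv[OF M zero_in_interval x]
    by (simp add: sum_distrib_right sum_distrib_left sum_negf sum_subtractf left_diff_distrib right_diff_distrib variation_sym[OF x] mult_ac)
  also have "(\<Sum>i\<in>UNIV. \<Sum>j\<in>UNIV. \<Sum>q\<in>UNIV. ?h j i * ?\<Gamma> j l q * ?I q i)
     = (\<Sum>i\<in>UNIV. \<Sum>j\<in>UNIV. \<Sum>q\<in>UNIV. ?h i j * ?\<Gamma> i l q * ?I q j)" by (rule sum.swap)
  also have "(\<Sum>i\<in>UNIV. \<Sum>j\<in>UNIV. ?I i j * ?dh l j i) = (\<Sum>a\<in>UNIV. \<Sum>b\<in>UNIV. ?I a b * ?dh l a b)"
    by (subst sum.swap) (simp add: Is)
  also have "(\<Sum>i\<in>UNIV. \<Sum>j\<in>UNIV. \<Sum>q\<in>UNIV. ?h i j * ?\<Gamma> i l q * ?I q j)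
     = (\<Sum>p\<in>UNIV. \<Sum>q\<in>UNIV. \<Sum>r\<in>UNIV. ?I p q * (?\<Gamma> r p l * ?h q r))"
    unfolding sum_UNIV3
    by (rule sum.reindex_bij_witness[of _ "\<lambda>(p, q, r). (r, q, p)" "\<lambda>(r, q, p). (p, q, r)"])
      (auto simp: mult_ac variation_sym[OF x] Gs)
  finally have t: "pd l ln_det_var x / 2 = (\<Sum>a\<in>UNIV. \<Sum>b\<in>UNIV. ?I a b * ?dh l a b) / 2
     - (\<Sum>p\<in>UNIV. \<Sum>q\<in>UNIV. \<Sum>r\<in>UNIV. ?I p q * (?\<Gamma> r p l * ?h q r))" by simp
  show ?thesis
    unfolding W_var t div2_def cov2_def
    by (simp add: sum.distrib sum_subtractf right_diff_distrib distrib_left sum_distrib_left variation_sym[OF x, of l] mult_ac)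
qed

lemma ric_deriv:
  assumes x: "x \<in> B"
  shows "((\<lambda>s. ric (M s) j k x) has_real_derivative
    (\<Sum>p\<in>UNIV. pd p (christoffel_var p j k) x - pd j (christoffel_var p p k) x
      + (\<Sum>q\<in>UNIV. christoffel_var q j k x * christoffel (M 0) p p q x + christoffel (M 0) q j k x * christoffel_var p p q x
           - (christoffel_var q p k x * christoffel (M 0) p j q x + christoffel (M 0) q p k x * christoffel_var p j q x)))) (at 0)"
  unfolding ric_def riem_def
  by (auto intro!: derivative_eq_intros christoffel_var_deriv[OF x] pd_christoffel_var[OF x] sum.cong)

text \<open>Contracted Palatini identity. The products of \<open>A\<close> and \<open>\<Gamma>\<close> cancel against the derivatives of
  the inverse metric.\<close>

lemma ric_deriv_trace:
  assumes x: "x \<in> B"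
  shows "(\<Sum>j\<in>UNIV. \<Sum>k\<in>UNIV. ginv (M 0) j k x * deriv (\<lambda>s. ric (M s) j k x) 0) =
    (\<Sum>j\<in>UNIV. \<Sum>k\<in>UNIV. ginv (M 0) j k x * cov1 (M 0) W_var j k x)
     - (\<Sum>j\<in>UNIV. \<Sum>k\<in>UNIV. ginv (M 0) j k x * cov1 (M 0) (\<lambda>k y. \<Sum>p\<in>UNIV. christoffel_var p p k y) j k x)"
proof -
  let ?I = "\<lambda>i j. ginv (M 0) i j x" and ?\<Gamma> = "\<lambda>k i j. christoffel (M 0) k i j x"
    and ?A = "\<lambda>k i j. christoffel_var k i j x" and ?a = "\<lambda>k. \<Sum>p\<in>UNIV. christoffel_var p p k x"
  note Is = ginv_sym[OF M zero_in_interval x] and Gs = christoffel_sym[OF M zero_in_interval x] and As = christoffel_var_sym[OF x]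
  \<comment> \<open>The field \<open>w\<close> with raised index, as a function of the point because
    its divergence is taken.\<close>
  define V where "V p y = (\<Sum>j\<in>UNIV. \<Sum>k\<in>UNIV. ginv (M 0) j k y * christoffel_var p j k y)" for p y
  \<comment> \<open>The numbers refer to the six terms of \<open>ric_deriv\<close>. The second and
    the fourth form the covariant derivative of the trace of \<open>A\<close>, and the sixth
    contracts to the same value as the fifth.\<close>
  define T1 where "T1 = (\<Sum>j\<in>UNIV. \<Sum>k\<in>UNIV. \<Sum>p\<in>UNIV. ?I j k * pd p (christoffel_var p j k) x)"
  define T3 where "T3 = (\<Sum>j\<in>UNIV. \<Sum>k\<in>UNIV. \<Sum>p\<in>UNIV. \<Sum>q\<in>UNIV. ?I j k * (?A q j k * ?\<Gamma> p p q))"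
  define T5 where "T5 = (\<Sum>j\<in>UNIV. \<Sum>k\<in>UNIV. \<Sum>p\<in>UNIV. \<Sum>q\<in>UNIV. ?I j k * (?A q p k * ?\<Gamma> p j q))"
  have T6: "(\<Sum>j\<in>UNIV. \<Sum>k\<in>UNIV. \<Sum>p\<in>UNIV. \<Sum>q\<in>UNIV. ?I j k * (?\<Gamma> q p k * ?A p j q)) = T5"
    unfolding T5_def sum_UNIV4
    by (rule sum.reindex_bij_witness[of _ "\<lambda>(j, k, p, q). (k, j, q, p)" "\<lambda>(j, k, p, q). (k, j, q, p)"])
      (auto simp: mult_ac Is Gs As)
  have a: "cov1 (M 0) (\<lambda>k y. \<Sum>p\<in>UNIV. christoffel_var p p k y) j k x
     = (\<Sum>p\<in>UNIV. pd j (christoffel_var p p k) x) - (\<Sum>p\<in>UNIV. \<Sum>q\<in>UNIV. ?\<Gamma> q j k * ?A p p q)" for j k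
    unfolding cov1_def by (simp add: pd_sum christoffel_var_differentiable[OF x] sum_distrib_left) (rule sum.swap)
  have "(\<Sum>j\<in>UNIV. \<Sum>k\<in>UNIV. ?I j k * deriv (\<lambda>s. ric (M s) j k x) 0)
     = T1 + T3 - T5 - T5 - (\<Sum>j\<in>UNIV. \<Sum>k\<in>UNIV. ?I j k * cov1 (M 0) (\<lambda>k y. \<Sum>p\<in>UNIV. christoffel_var p p k y) j k x)"
    unfolding a DERIV_imp_deriv[OF ric_deriv[OF x]] T1_def T3_def
    by (subst T6[symmetric], unfold T5_def)
      (simp add: sum.distrib sum_subtractf distrib_left right_diff_distrib sum_distrib_left)
  also have "T1 + T3 - T5 - T5 = (\<Sum>p\<in>UNIV. pd p (V p) x) + (\<Sum>q\<in>UNIV. V q x * (\<Sum>p\<in>UNIV. ?\<Gamma> p p q))"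
  proof -
    have "(\<Sum>q\<in>UNIV. V q x * (\<Sum>p\<in>UNIV. ?\<Gamma> p p q))
       = (\<Sum>q\<in>UNIV. \<Sum>j\<in>UNIV. \<Sum>k\<in>UNIV. \<Sum>p\<in>UNIV. ?I j k * (?A q j k * ?\<Gamma> p p q))"
      by (simp add: V_def sum_distrib_left sum_distrib_right mult_ac)
    also have "\<dots> = T3"
      unfolding T3_def sum_UNIV4
      by (rule sum.reindex_bij_witness[of _ "\<lambda>(j, k, p, q). (q, j, k, p)" "\<lambda>(q, j, k, p). (j, k, p, q)"]) auto
    finally have 3: "(\<Sum>q\<in>UNIV. V q x * (\<Sum>p\<in>UNIV. ?\<Gamma> p p q)) = T3" .
    have "(\<Sum>p\<in>UNIV. pd p (V p) x) = (\<Sum>p\<in>UNIV. \<Sum>j\<in>UNIV. \<Sum>k\<in>UNIV. ?I j k * pd p (christoffel_var p j k) x)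
        + (\<Sum>p\<in>UNIV. \<Sum>j\<in>UNIV. \<Sum>k\<in>UNIV. pd p (ginv (M 0) j k) x * ?A p j k)"
      by (simp add: V_def[abs_def] pd_sum pd_mult differentiable_sum differentiable_mult
          differentiable_ginv[OF M zero_in_interval x] christoffel_var_differentiable[OF x] sum.distrib)
    also have "(\<Sum>p\<in>UNIV. \<Sum>j\<in>UNIV. \<Sum>k\<in>UNIV. ?I j k * pd p (christoffel_var p j k) x) = T1"
      unfolding T1_def sum_UNIV3
      by (rule sum.reindex_bij_witness[of _ "\<lambda>(j, k, p). (p, j, k)" "\<lambda>(p, j, k). (j, k, p)"]) auto
    also have "(\<Sum>p\<in>UNIV. \<Sum>j\<in>UNIV. \<Sum>k\<in>UNIV. pd p (ginv (M 0) j k) x * ?A p j k) =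
      - (\<Sum>p\<in>UNIV. \<Sum>j\<in>UNIV. \<Sum>k\<in>UNIV. \<Sum>q\<in>UNIV. ?\<Gamma> j p q * ?I q k * ?A p j k)
      - (\<Sum>p\<in>UNIV. \<Sum>j\<in>UNIV. \<Sum>k\<in>UNIV. \<Sum>q\<in>UNIV. ?\<Gamma> k p q * ?I q j * ?A p j k)"
      unfolding pd_ginv[OF M zero_in_interval x]
      by (simp add: left_diff_distrib sum_subtractf sum_negf sum_distrib_right)
    also have "(\<Sum>p\<in>UNIV. \<Sum>j\<in>UNIV. \<Sum>k\<in>UNIV. \<Sum>q\<in>UNIV. ?\<Gamma> j p q * ?I q k * ?A p j k) = T5"
      unfolding T5_def sum_UNIV4
      by (rule sum.reindex_bij_witness[of _ "\<lambda>(j, k, p, q). (q, p, k, j)" "\<lambda>(q, p, k, j). (j, k, p, q)"])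
        (auto simp: mult_ac Is Gs As)
    also have "(\<Sum>p\<in>UNIV. \<Sum>j\<in>UNIV. \<Sum>k\<in>UNIV. \<Sum>q\<in>UNIV. ?\<Gamma> k p q * ?I q j * ?A p j k) = T5"
      unfolding T5_def sum_UNIV4
      by (rule sum.reindex_bij_witness[of _ "\<lambda>(j, k, p, q). (q, k, p, j)" "\<lambda>(q, k, p, j). (j, k, p, q)"])
        (auto simp: mult_ac Is Gs As)
    finally show ?thesis unfolding 3 by simp
  qed
  also have "\<dots> = (\<Sum>i\<in>UNIV. \<Sum>j\<in>UNIV. ?I i j * cov1 (M 0) (\<lambda>j y. \<Sum>k\<in>UNIV. M 0 y $ j $ k * V k y) i j x)"
    by (rule divergence_lowered[OF M zero_in_interval x, symmetric])
      (simp add: V_def[abs_def] differentiable_sum differentiable_mult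
          differentiable_ginv[OF M zero_in_interval x] christoffel_var_differentiable[OF x])
  also have "\<dots> = (\<Sum>i\<in>UNIV. \<Sum>j\<in>UNIV. ?I i j * cov1 (M 0) W_var i j x)"
  proof (intro sum.cong refl arg_cong2[of _ _ _ _ "(*)"])
    fix i j
    have "pd i (W_var j) x = pd i (\<lambda>y. \<Sum>k\<in>UNIV. M 0 y $ j $ k * V k y) x"
      by (rule pd_cong[OF metric_family_open[OF M] x]) (simp add: V_def W_var_eq)
    then show "cov1 (M 0) (\<lambda>j y. \<Sum>k\<in>UNIV. M 0 y $ j $ k * V k y) i j x = cov1 (M 0) W_var i j x"
      unfolding cov1_def by (simp add: V_def W_var_eq[OF x])
  qed
  finally show ?thesis .
qed

text \<open>The identity \<open>div h = w + a\<close> holds on the whole open set \<open>B\<close>,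
  so it may be differentiated covariantly.\<close>

lemma divdiv_eq:
  assumes x: "x \<in> B"
  shows "divdiv (M 0) h x = (\<Sum>j\<in>UNIV. \<Sum>k\<in>UNIV. ginv (M 0) j k x * cov1 (M 0) W_var j k x)
     + (\<Sum>j\<in>UNIV. \<Sum>k\<in>UNIV. ginv (M 0) j k x * cov1 (M 0) (\<lambda>k y. \<Sum>p\<in>UNIV. christoffel_var p p k y) j k x)"
proof -
  have d: "div2 (M 0) h k y = W_var k y + (\<Sum>p\<in>UNIV. christoffel_var p p k y)" if "y \<in> B" for k y
    using that by (simp add: W_var_plus_trace[symmetric] christoffel_var_trace)
  have "cov1 (M 0) (div2 (M 0) h) j k x
    = cov1 (M 0) W_var j k x + cov1 (M 0) (\<lambda>k y. \<Sum>p\<in>UNIV. christoffel_var p p k y) j k x" for j k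
  proof -
    have "pd j (div2 (M 0) h k) x = pd j (\<lambda>y. W_var k y + (\<Sum>p\<in>UNIV. christoffel_var p p k y)) x"
      by (rule pd_cong[OF metric_family_open[OF M] x d])
    then show ?thesis
      unfolding cov1_def d[OF x]
      by (simp add: pd_add W_var_differentiable[OF x] differentiable_sum christoffel_var_differentiable[OF x] distrib_left sum.distrib)
  qed
  then show ?thesis
    by (simp add: divdiv_def distrib_left sum.distrib)
qed

text \<open>The Palatini identity yields \<open>div w - div a\<close>. Rewriting
  \<open>div a\<close> as \<open>div (div h) - div w\<close> produces the combination that is needed
  for the time component.\<close>

lemma scal_deriv:
  assumes x: "x \<in> B"
  shows "((\<lambda>s. scal (M s) x) has_real_derivative
    2 * (\<Sum>j\<in>UNIV. \<Sum>k\<in>UNIV. ginv (M 0) j k x * cov1 (M 0) W_var j k x)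
      - (divdiv (M 0) h x + ric_dot (M 0) h x)) (at 0)"
proof -
  let ?I = "\<lambda>i j. ginv (M 0) i j x"
  have r: "((\<lambda>s. ric (M s) j k x) has_real_derivative deriv (\<lambda>s. ric (M s) j k x) 0) (at 0)" for j k
    by (rule base_deriv[OF smooth_ric[OF M] x])
  have "((\<lambda>s. scal (M s) x) has_real_derivative
     (\<Sum>j\<in>UNIV. \<Sum>k\<in>UNIV. ?I j k * deriv (\<lambda>s. ric (M s) j k x) 0
       + - (\<Sum>a\<in>UNIV. \<Sum>b\<in>UNIV. ?I j a * h x $ a $ b * ?I b k) * ric (M 0) j k x)) (at 0)"
    unfolding scal_def by (intro DERIV_sum DERIV_mult' ginv_deriv x r)
  also have "(\<Sum>j\<in>UNIV. \<Sum>k\<in>UNIV. ?I j k * deriv (\<lambda>s. ric (M s) j k x) 0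
       + - (\<Sum>a\<in>UNIV. \<Sum>b\<in>UNIV. ?I j a * h x $ a $ b * ?I b k) * ric (M 0) j k x)
     = (\<Sum>j\<in>UNIV. \<Sum>k\<in>UNIV. ?I j k * deriv (\<lambda>s. ric (M s) j k x) 0) - ric_dot (M 0) h x"
    by (simp add: ric_dot_def sum.distrib sum_negf sum_subtractf sum_distrib_left sum_distrib_right mult_ac
        ginv_sym[OF M zero_in_interval x])
  finally show ?thesis
    unfolding ric_deriv_trace[OF x] divdiv_eq[OF x] by (simp add: algebra_simps)
qed

text \<open>\<open>W\<close> vanishes identically in \<open>x\<close> at \<open>s = 0\<close>, and
  so do its spatial derivatives. Hence the variations of the inverse metric and of the connection
  meet zero factors, and only \<open>w\<close> is left.\<close>

lemma divergence_W_deriv: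
  assumes x: "x \<in> B"
  shows "((\<lambda>s. \<Sum>i\<in>UNIV. \<Sum>j\<in>UNIV. ginv (M s) i j x * cov1 (M s) (W_low (M s) (M 0)) i j x) has_real_derivative
    (\<Sum>i\<in>UNIV. \<Sum>j\<in>UNIV. ginv (M 0) i j x * cov1 (M 0) W_var i j x)) (at 0)"
proof -
  have z: "W_low (M 0) (M 0) j y = 0" for j y by (simp add: W_low_def W_up_zero)
  have c: "((\<lambda>s. cov1 (M s) (W_low (M s) (M 0)) i j x) has_real_derivative cov1 (M 0) W_var i j x) (at 0)" for i j
    unfolding cov1_def
    by (auto intro!: derivative_eq_intros pd_W_var[OF x] W_low_deriv[OF x] christoffel_var_deriv[OF x] sum.cong simp: z)
  have c0: "cov1 (M 0) (W_low (M 0) (M 0)) i j x = 0" for i j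
    by (simp add: cov1_def z pd_const[of _ 0, unfolded fun_eq_iff] pd_cong[OF open_UNIV UNIV_I z] pd_const)
  show ?thesis
    by (auto intro!: derivative_eq_intros ginv_deriv[OF x] c sum.cong simp: c0)
qed

text \<open>The norm is quadratic in \<open>W\<close>, which vanishes at
  \<open>s = 0\<close>.\<close>

lemma W_norm2_deriv:
  assumes x: "x \<in> B" shows "((\<lambda>s. W_norm2 (M s) (M 0) x) has_real_derivative 0) (at 0)"
  unfolding W_norm2_def
  by (auto intro!: derivative_eq_intros W_up_deriv[OF x] h[OF x] simp: W_up_zero)

text \<open>The logarithm of the quotient splits on \<open>B\<close>. The background part is
  constant in \<open>s\<close>, and the rest is \<open>w\<close> plus half the gradient of the
  trace.\<close>

lemma mixed_deriv:
  assumes x: "x \<in> B"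
  shows "((\<lambda>s. W_low (M s) (M 0) j x + pd j (log_det_ratio (M s) (M 0)) x / 2)
     has_real_derivative div2 (M 0) h j x) (at 0)"
proof -
  have d: "((\<lambda>s. W_low (M s) (M 0) j x +
       (pd j (\<lambda>y. ln (det (M s y))) x - pd j (\<lambda>y. ln (det (M 0 y))) x) / 2)
     has_real_derivative div2 (M 0) h j x) (at 0)"
    by (auto intro!: derivative_eq_intros W_low_deriv[OF x] pd_ln_det_var[OF x] simp: W_var_plus_trace[OF x, symmetric])
  have "pd j (log_det_ratio (M s) (M 0)) x
      = pd j (\<lambda>y. ln (det (M s y))) x - pd j (\<lambda>y. ln (det (M 0 y))) x" if s: "s \<in> {-\<sigma><..<\<sigma>}" for s
  proof -
    have "pd j (log_det_ratio (M s) (M 0)) x = pd j (\<lambda>y. ln (det (M s y)) - ln (det (M 0 y))) x"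
      by (rule pd_cong[OF metric_family_open[OF M] x])
        (simp add: log_det_ratio_def ln_div metric_det_nz[OF M s] metric_det_nz[OF M zero_in_interval]
          metric_det_pos[OF M s] metric_det_pos[OF M zero_in_interval])
    then show ?thesis
      using smooth_family_differentiable[OF smooth_ln_det[OF M] metric_family_open[OF M] _ x] s zero_in_interval
      by (simp add: pd_diff)
  qed
  then show ?thesis
    by (intro has_field_derivative_transform_within_open[OF d open_greaterThanLessThan zero_in_interval]) simp
qed

end

section \<open>The space-time metric\<close>

lemma sum_UNIV_option:
  fixes f :: "'n::finite option \<Rightarrow> 'a::comm_monoid_add"
  shows "(\<Sum>a\<in>UNIV. f a) = f None + (\<Sum>i\<in>UNIV. f (Some i))"
  by (simp add: UNIV_option_conv sum.reindex)

text \<open>Completing the square (Schur complement).\<close>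

lemma positive_definite_bordered:
  fixes m :: "real^'n::finite^'n" and b :: "'n \<Rightarrow> real" and H :: "real^('n option)^('n option)"
  assumes m: "positive_definite m"
    and d: "(\<Sum>i\<in>UNIV. \<Sum>j\<in>UNIV. matrix_inv m $ i $ j * b i * b j) < H $ None $ None"
    and H: "\<And>i j. H $ Some i $ Some j = m $ i $ j" "\<And>i. H $ Some i $ None = b i" "\<And>i. H $ None $ Some i = b i"
  shows "positive_definite H"
  unfolding positive_definite_def
proof (intro conjI allI impI)
  have sym: "m $ i $ j = m $ j $ i" for i j
  proof -
    have "transpose m $ i $ j = m $ i $ j" using m by (simp add: positive_definite_def)
    then show ?thesis by (simp add: transpose_def)
  qed
  have "H $ j $ i = H $ i $ j" for i j
    by (cases i; cases j) (simp_all add: H sym)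
  then show "transpose H = H" by (simp add: transpose_def vec_eq_iff)
  fix v :: "real^('n option)" assume v: "v \<noteq> 0"
  define r where "r = v $ None"
  define u where "u i = v $ Some i" for i
  \<comment> \<open>\<open>\<beta>\<close> solves \<open>m \<beta> = b\<close>. With
    \<open>z = u + r \<beta>\<close> the form of \<open>H\<close> at \<open>v\<close> becomes that
    of \<open>m\<close> at \<open>z\<close> plus \<open>r^2\<close> times the Schur
    complement.\<close>
  define \<beta> where "\<beta> i = (\<Sum>j\<in>UNIV. matrix_inv m $ i $ j * b j)" for i
  define z where "z = (\<chi> i. u i + r * \<beta> i)"
  have mb: "(\<Sum>j\<in>UNIV. m $ i $ j * \<beta> j) = b i" for i
  proof -
    have "(\<Sum>j\<in>UNIV. m $ i $ j * \<beta> j) = (\<Sum>k\<in>UNIV. (\<Sum>j\<in>UNIV. m $ i $ j * matrix_inv m $ j $ k) * b k)"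
      by (simp add: \<beta>_def sum_distrib_left sum_distrib_right mult.assoc) (rule sum.swap)
    then show ?thesis
      by (simp add: matrix_inv_contract[OF positive_definite_det_nonzero[OF m]] if_distrib[of "\<lambda>z. z * _"] cong: if_cong)
  qed
  have mz: "(m *v z) $ i = (\<Sum>j\<in>UNIV. m $ i $ j * u j) + r * b i" for i
    unfolding mb[symmetric] by (simp add: matrix_vector_mult_def z_def distrib_left sum.distrib sum_distrib_left mult_ac)
  have \<beta>mu: "(\<Sum>i\<in>UNIV. \<beta> i * (\<Sum>j\<in>UNIV. m $ i $ j * u j)) = (\<Sum>j\<in>UNIV. b j * u j)"
    unfolding mb[symmetric] sum_distrib_left sum_distrib_right
    by (subst sum.swap) (simp add: mult_ac sym)
  have "z \<bullet> (m *v z) = (\<Sum>i\<in>UNIV. u i * (\<Sum>j\<in>UNIV. m $ i $ j * u j)) + 2 * r * (\<Sum>j\<in>UNIV. b j * u j)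
      + r\<^sup>2 * (\<Sum>i\<in>UNIV. \<beta> i * b i)"
  proof -
    define mu where "mu i = (\<Sum>j\<in>UNIV. m $ i $ j * u j)" for i
    have "z \<bullet> (m *v z) = (\<Sum>i\<in>UNIV. u i * mu i + r * (b i * u i) + r * (\<beta> i * mu i) + r\<^sup>2 * (\<beta> i * b i))"
      unfolding inner_vec_def mz mu_def[symmetric]
      by (intro sum.cong refl) (simp add: z_def algebra_simps power2_eq_square)
    also have "\<dots> = (\<Sum>i\<in>UNIV. u i * mu i) + r * (\<Sum>j\<in>UNIV. b j * u j) + r * (\<Sum>i\<in>UNIV. \<beta> i * mu i)
        + r\<^sup>2 * (\<Sum>i\<in>UNIV. \<beta> i * b i)"
      by (simp add: sum.distrib sum_distrib_left)
    finally show ?thesis unfolding mu_def \<beta>mu by simp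
  qed
  moreover have "v \<bullet> (H *v v) = (\<Sum>i\<in>UNIV. u i * (\<Sum>j\<in>UNIV. m $ i $ j * u j)) + 2 * r * (\<Sum>j\<in>UNIV. b j * u j)
      + r\<^sup>2 * H $ None $ None"
    by (simp add: inner_vec_def matrix_vector_mult_def sum_UNIV_option H r_def[symmetric] u_def[symmetric]
        distrib_left sum.distrib sum_distrib_left power2_eq_square mult_ac)
  ultimately have eq: "v \<bullet> (H *v v) = z \<bullet> (m *v z) + r\<^sup>2 * (H $ None $ None - (\<Sum>i\<in>UNIV. \<beta> i * b i))"
    by (simp add: algebra_simps)
  have pos: "H $ None $ None - (\<Sum>i\<in>UNIV. \<beta> i * b i) > 0"
    using d by (simp add: \<beta>_def sum_distrib_left sum_distrib_right mult_ac)
  show "v \<bullet> (H *v v) > 0"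
  proof (cases "r = 0")
    case True
    have "\<exists>a. v $ a \<noteq> 0" using v by (simp add: vec_eq_iff)
    then obtain i where "u i \<noteq> 0" using True unfolding r_def u_def by (metis not_None_eq)
    then have "z \<noteq> 0" using True by (auto simp: z_def vec_eq_iff)
    then show ?thesis using m True by (simp add: eq positive_definite_def)
  next
    case False
    have "z \<bullet> (m *v z) \<ge> 0" using m by (cases "z = 0") (auto simp: positive_definite_def less_imp_le)
    moreover have "r\<^sup>2 * (H $ None $ None - (\<Sum>i\<in>UNIV. \<beta> i * b i)) > 0" using pos False by simp
    ultimately show ?thesis unfolding eq by linarith
  qed
qed

section \<open>Locality in the metric, for replacing \<open>g t 0\<close> by
  \<open>\<gamma> t\<close>, which agree on chart coordinates\<close>

context
  fixes B :: "(real^'n::finite) set" and m m' :: "real^'n \<Rightarrow> real^'n^'n"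
  assumes B: "open B" and eq: "\<And>y. y \<in> B \<Longrightarrow> m y = m' y"
begin

lemma ginv_cong: "x \<in> B \<Longrightarrow> ginv m i j x = ginv m' i j x"
  by (simp add: ginv_def eq)

lemma christoffel_cong:
  assumes x: "x \<in> B" shows "christoffel m k i j x = christoffel m' k i j x"
proof -
  have "pd k (\<lambda>y. m y $ i $ j) x = pd k (\<lambda>y. m' y $ i $ j) x" for k i j
    by (rule pd_cong[OF B x]) (simp add: eq)
  then show ?thesis by (simp add: christoffel_def ginv_cong[OF x])
qed

lemma ric_cong:
  assumes x: "x \<in> B" shows "ric m j k x = ric m' j k x"
proof -
  have "pd l (christoffel m k i j) x = pd l (christoffel m' k i j) x" for l k i j
    by (rule pd_cong[OF B x christoffel_cong])
  then show ?thesis by (simp add: ric_def riem_def christoffel_cong[OF x])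
qed

lemma div2_cong: "x \<in> B \<Longrightarrow> div2 m b j x = div2 m' b j x"
  by (simp add: div2_def cov2_def ginv_cong christoffel_cong)

lemma divdiv_cong:
  assumes x: "x \<in> B" shows "divdiv m b x = divdiv m' b x"
proof -
  have "pd l (div2 m b k) x = pd l (div2 m' b k) x" for l k
    by (rule pd_cong[OF B x div2_cong])
  then show ?thesis
    by (simp add: divdiv_def cov1_def ginv_cong[OF x] christoffel_cong[OF x] div2_cong[OF x])
qed

lemma ric_dot_cong: "x \<in> B \<Longrightarrow> ric_dot m b x = ric_dot m' b x"
  by (simp add: ric_dot_def ginv_cong ric_cong)

end

text \<open>Derivatives within the time interval are unique only at limit points. A real
  \<open>u\<close> strictly between \<open>t\<close> and \<open>T\<close> treats finite and infinite
  \<open>T\<close> alike and also covers \<open>t = 0\<close>.\<close>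

lemma time_interval_limit_point:
  assumes "t \<in> time_interval T" shows "at t within time_interval T \<noteq> bot"
proof -
  obtain u where u: "ereal t < ereal u" "ereal u < T"
    using assms ereal_dense2[of "ereal t" T] by (auto simp: time_interval_def)
  have "{t<..<u} \<subseteq> time_interval T"
    using assms u by (auto simp: time_interval_def) (metis ereal_less_eq(3) less_imp_le order_le_less_trans)
  moreover have "t islimpt {t<..<u}" using u by (simp add: islimpt_greaterThanLessThan1)
  ultimately show ?thesis using islimpt_subset trivial_limit_within by blast
qed

lemma g_hat_entries:
  "g_hat T g N s c t x $ Some i $ Some j = g t s c x $ i $ j"
  "g_hat T g N s c t x $ Some i $ None
     = W_low (g t s c) (g t 0 c) i x + pd i (log_det_ratio (g t s c) (g t 0 c)) x / 2"
  "g_hat T g N s c t x $ None $ Some i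
     = W_low (g t s c) (g t 0 c) i x + pd i (log_det_ratio (g t s c) (g t 0 c)) x / 2"
  "g_hat T g N s c t x $ None $ None = scal (g t s c) x + W_norm2 (g t s c) (g t 0 c) x
     + vector_derivative (\<lambda>\<tau>. log_det_ratio (g \<tau> s c) (g \<tau> 0 c) x) (at t within time_interval T) + N"
  by (simp_all add: g_hat_def Let_def)

section \<open>The modified flow in one chart\<close>

context
  fixes A :: "('m::{t2_space, second_countable_topology}, 'n::finite) chart set"
    and T :: ereal and \<sigma> :: real and g :: "real \<Rightarrow> real \<Rightarrow> ('m, 'n) tensor2" and c :: "('m, 'n) chart"
  assumes atlas: "smooth_atlas A" and \<sigma>: "0 < \<sigma>" and flow: "modified_ricci_flow_family A T \<sigma> g" and c: "c \<in> A"
begin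

lemma metric_family_flow:
  "metric_family (time_interval T \<times> {-\<sigma><..<\<sigma>}) (coords c) (\<lambda>p. g (fst p) (snd p) c)"
  unfolding metric_family_def
proof (intro conjI ballI)
  show "open (coords c)" using atlas c by (simp add: smooth_atlas_def)
  have "smooth_on (time_interval T \<times> {-\<sigma><..<\<sigma>} \<times> coords c) (\<lambda>(t, s, x). g t s c x)"
    using flow c by (simp add: modified_ricci_flow_family_def)
  moreover have "((\<lambda>z. (fst (fst z), snd (fst z), snd z)) has_derivative
      (\<lambda>z. (fst (fst z), snd (fst z), snd z))) (at z)" for z :: "(real \<times> real) \<times> (real^'n)"
    by (auto intro!: derivative_eq_intros)
  ultimately have "smooth_on ((time_interval T \<times> {-\<sigma><..<\<sigma>}) \<times> coords c)
      (\<lambda>z. (\<lambda>(t, s, x). g t s c x) (fst (fst z), snd (fst z), snd z))"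
    by (intro smooth_on_compose_affine[where L = "\<lambda>z. (fst (fst z), snd (fst z), snd z)"]) auto
  then show "smooth_family (time_interval T \<times> {-\<sigma><..<\<sigma>}) (coords c) (\<lambda>p. g (fst p) (snd p) c)"
    by (simp add: smooth_family_def)
  show "positive_definite (g (fst p) (snd p) c x)"
    if "p \<in> time_interval T \<times> {-\<sigma><..<\<sigma>}" "x \<in> coords c" for p x
    using flow c that by (auto simp: modified_ricci_flow_family_def riemannian_metric_def)
qed

text \<open>The background is viewed as a family in \<open>(t,s)\<close> that is constant in
  \<open>s\<close>, because the rules for \<open>W\<close> expect both metrics over the same
  parameter set.\<close>

lemma metric_family_background:
  "metric_family (time_interval T \<times> {-\<sigma><..<\<sigma>}) (coords c) (\<lambda>p. g (fst p) 0 c)"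
proof -
  have "((\<lambda>p. (fst p, 0)) has_derivative (\<lambda>p. (fst p, 0))) (at p)" for p :: "real \<times> real"
    by (auto intro!: derivative_eq_intros)
  then show ?thesis
    by (rule metric_family_reparam[OF metric_family_flow, of "\<lambda>p. (fst p, 0)", simplified])
      (use \<sigma> in auto)
qed

text \<open>At fixed time the parameter set is an open interval, as the exchange of derivatives
  demands, even at \<open>t = 0\<close>.\<close>

lemma metric_family_slice:
  assumes "t \<in> time_interval T" shows "metric_family {-\<sigma><..<\<sigma>} (coords c) (\<lambda>s. g t s c)"
proof -
  have "((\<lambda>s. (t, s)) has_derivative (\<lambda>s. (0, s))) (at s)" for s :: real
    by (auto intro!: derivative_eq_intros)
  then show ?thesis
    by (rule metric_family_reparam[OF metric_family_flow, of "\<lambda>s. (t, s)", simplified])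
      (use assms in auto)
qed

lemma ln_det_flow:
  assumes t: "t \<in> time_interval T" and s: "s \<in> {-\<sigma><..<\<sigma>}" and x: "x \<in> coords c"
  shows "((\<lambda>\<tau>. ln (det (g \<tau> s c x))) has_real_derivative
     2 * (\<Sum>i\<in>UNIV. \<Sum>j\<in>UNIV. ginv (g t s c) i j x * cov1 (g t s c) (W_low (g t s c) (g t 0 c)) i j x)
      - 2 * scal (g t s c) x) (at t within time_interval T)"
proof -
  let ?I = "\<lambda>i j. ginv (g t s c) i j x" and ?W = "\<lambda>i j. cov1 (g t s c) (W_low (g t s c) (g t 0 c)) i j x"
    and ?R = "\<lambda>i j. ric (g t s c) i j x"
  note Is = ginv_sym[OF metric_family_slice[OF t] s x]
  have "((\<lambda>\<tau>. g \<tau> s c x $ i $ j) has_real_derivative - 2 * ?R i j + ?W i j + ?W j i) (at t within time_interval T)" for i j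
    using flow c t s x by (simp add: modified_ricci_flow_family_def)
  then have "((\<lambda>\<tau>. ln (det (g \<tau> s c x))) has_real_derivative
     (\<Sum>i\<in>UNIV. \<Sum>j\<in>UNIV. ?I i j * (- 2 * ?R j i + ?W j i + ?W i j))) (at t within time_interval T)"
    unfolding ginv_def
    by (rule has_real_derivative_ln_det) (rule metric_det_pos[OF metric_family_slice[OF t] s x])
  also have "(\<Sum>i\<in>UNIV. \<Sum>j\<in>UNIV. ?I i j * (- 2 * ?R j i + ?W j i + ?W i j))
     = - 2 * (\<Sum>i\<in>UNIV. \<Sum>j\<in>UNIV. ?I i j * ?R j i) + (\<Sum>i\<in>UNIV. \<Sum>j\<in>UNIV. ?I i j * ?W j i)
       + (\<Sum>i\<in>UNIV. \<Sum>j\<in>UNIV. ?I i j * ?W i j)"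
    by (simp add: distrib_left right_diff_distrib sum.distrib sum_subtractf sum_negf sum_distrib_left mult_ac)
  also have "(\<Sum>i\<in>UNIV. \<Sum>j\<in>UNIV. ?I i j * ?R j i) = scal (g t s c) x"
    unfolding scal_def by (subst sum.swap) (simp add: Is)
  also have "(\<Sum>i\<in>UNIV. \<Sum>j\<in>UNIV. ?I i j * ?W j i) = (\<Sum>i\<in>UNIV. \<Sum>j\<in>UNIV. ?I i j * ?W i j)"
    by (subst sum.swap) (simp add: Is)
  finally show ?thesis by (simp add: algebra_simps)
qed

lemma cov1_W_low_self: "cov1 m (W_low m m) i j x = 0"
proof -
  have "W_low m m k y = 0" for k y by (simp add: W_low_def W_up_def)
  then show ?thesis by (simp add: cov1_def pd_def)
qed

text \<open>The time component without \<open>N\<close> and without time derivatives. The term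
  \<open>R\<close> together with \<open>-2 R\<close> from the determinant of \<open>g t s\<close>
  leaves \<open>- R\<close>, and the determinant of the background contributes \<open>+ 2 R\<close>
  of \<open>g t 0\<close>.\<close>

definition g_hat_00 where
  "g_hat_00 t s x = W_norm2 (g t s c) (g t 0 c) x - scal (g t s c) x + 2 * scal (g t 0 c) x
     + 2 * (\<Sum>i\<in>UNIV. \<Sum>j\<in>UNIV. ginv (g t s c) i j x * cov1 (g t s c) (W_low (g t s c) (g t 0 c)) i j x)"

text \<open>Taking the trace of the flow equation expresses the time derivative of the determinant
  through spatial derivatives.\<close>

lemma g_hat_None_None:
  assumes t: "t \<in> time_interval T" and s: "s \<in> {-\<sigma><..<\<sigma>}" and x: "x \<in> coords c"
  shows "g_hat T g N s c t x $ None $ None = g_hat_00 t s x + N"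
proof -
  have z: "0 \<in> {-\<sigma><..<\<sigma>}" using \<sigma> by simp
  \<comment> \<open>Positivity of both determinants is known at times of the interval, and a
    derivative within the interval sees no other times.\<close>
  have "log_det_ratio (g \<tau> s c) (g \<tau> 0 c) x = ln (det (g \<tau> s c x)) - ln (det (g \<tau> 0 c x))"
    if \<tau>: "\<tau> \<in> time_interval T" for \<tau>
    using metric_det_pos[OF metric_family_slice[OF \<tau>] s x] metric_det_pos[OF metric_family_slice[OF \<tau>] z x]
    by (simp add: log_det_ratio_def ln_div)
  moreover have "((\<lambda>\<tau>. ln (det (g \<tau> s c x)) - ln (det (g \<tau> 0 c x))) has_real_derivative
     g_hat_00 t s x - W_norm2 (g t s c) (g t 0 c) x - scal (g t s c) x) (at t within time_interval T)"
    by (rule DERIV_cong[OF DERIV_diff[OF ln_det_flow[OF t s x] ln_det_flow[OF t z x]]])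
      (simp add: g_hat_00_def cov1_W_low_self)
  ultimately have "((\<lambda>\<tau>. log_det_ratio (g \<tau> s c) (g \<tau> 0 c) x) has_real_derivative
     g_hat_00 t s x - W_norm2 (g t s c) (g t 0 c) x - scal (g t s c) x) (at t within time_interval T)"
    using t by (simp add: has_field_derivative_cong_eventually[OF eventually_at_topological[THEN iffD2]]
        has_field_derivative_transform_within[where d = 1])
  then have "vector_derivative (\<lambda>\<tau>. log_det_ratio (g \<tau> s c) (g \<tau> 0 c) x) (at t within time_interval T)
      = g_hat_00 t s x - W_norm2 (g t s c) (g t 0 c) x - scal (g t s c) x"
    by (intro vector_derivative_within[OF time_interval_limit_point[OF t]])
      (simp add: has_real_derivative_iff_has_vector_derivative)
  then show ?thesis by (simp add: g_hat_entries)
qed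

text \<open>In the time component \<open>- R\<close> contributes \<open>- 2 div w\<close> and the
  DeTurck term contributes \<open>2 div w\<close>. These cancel, and
  \<open>div (div h) + Rc \<cdot> h\<close> remains.\<close>

lemma g_hat_variation:
  assumes \<gamma>: "\<And>y. y \<in> coords c \<Longrightarrow> g t 0 c y = \<gamma> t c y" and t: "t \<in> time_interval T" and x: "x \<in> coords c"
    and h: "\<And>y i j. y \<in> coords c \<Longrightarrow> ((\<lambda>s. g t s c y $ i $ j) has_real_derivative h t c y $ i $ j) (at 0)"
  shows "((\<lambda>s. g_hat T g N s c t x $ a $ b) has_real_derivative h_tilde \<gamma> h c t x $ a $ b) (at 0)"
proof -
  note M = metric_family_slice[OF t]
  have oB: "open (coords c)" by (rule metric_family_open[OF M])
  have z: "0 \<in> {-\<sigma><..<\<sigma>}" using \<sigma> by simp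
  have mixed: "((\<lambda>s. W_low (g t s c) (g t 0 c) i x + pd i (log_det_ratio (g t s c) (g t 0 c)) x / 2)
      has_real_derivative div2 (\<gamma> t c) (h t c) i x) (at 0)" for i
    using mixed_deriv[OF \<sigma> M h x, of i] div2_cong[OF oB, of "g t 0 c" "\<gamma> t c", OF \<gamma> x] by simp
  have "((\<lambda>s. g_hat_00 t s x + N) has_real_derivative divdiv (g t 0 c) (h t c) x + ric_dot (g t 0 c) (h t c) x) (at 0)"
    unfolding g_hat_00_def
    by (rule derivative_eq_intros scal_deriv[OF \<sigma> M h x] divergence_W_deriv[OF \<sigma> M h x] W_norm2_deriv[OF \<sigma> M h x] refl | simp)+
  then have "((\<lambda>s. g_hat T g N s c t x $ None $ None) has_real_derivative
      divdiv (g t 0 c) (h t c) x + ric_dot (g t 0 c) (h t c) x) (at 0)"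
    by (rule has_field_derivative_transform_within_open[OF _ open_greaterThanLessThan z])
      (simp add: g_hat_None_None[OF t _ x])
  then show ?thesis
    using h[OF x] mixed divdiv_cong[OF oB, of "g t 0 c" "\<gamma> t c", OF \<gamma> x]
      ric_dot_cong[OF oB, of "g t 0 c" "\<gamma> t c", OF \<gamma> x]
    by (cases a; cases b) (simp_all add: g_hat_entries(1-3) h_tilde_def)
qed

text \<open>The Schur condition reads \<open>Q < N\<close>, where \<open>Q\<close> is the squared
  length of the mixed part minus \<open>g_hat_00\<close>. As \<open>Q\<close> involves only spatial
  derivatives of smooth families, it is continuous up to \<open>t = 0\<close> and bounded on compact
  sets.\<close>

lemma g_hat_positive_definite:
  assumes K: "compact K" "K \<subseteq> time_interval T \<times> coords c"
  shows "\<exists>N0. \<exists>\<delta>>0. \<forall>N\<ge>N0. \<forall>s. \<bar>s\<bar> < \<delta> \<longrightarrow> (\<forall>(t, x)\<in>K. positive_definite (g_hat T g N s c t x))"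
proof -
  let ?P = "time_interval T \<times> {-\<sigma><..<\<sigma>}"
  let ?G = "\<lambda>p. g (fst p) (snd p) c" and ?bg = "\<lambda>p. g (fst p) 0 c"
  note M = metric_family_flow and M0 = metric_family_background
  define b where "b i p x = W_low (?G p) (?bg p) i x + pd i (log_det_ratio (?G p) (?bg p)) x / 2" for i and p :: "real \<times> real" and x
  define Q where "Q p x = (\<Sum>i\<in>UNIV. \<Sum>j\<in>UNIV. ginv (?G p) i j x * b i p x * b j p x) - g_hat_00 (fst p) (snd p) x" for p :: "real \<times> real" and x
  have ld: "smooth_family ?P (coords c) (\<lambda>p x. log_det_ratio (?G p) (?bg p) x)"
    unfolding log_det_ratio_def
    by (intro smooth_family_ln smooth_family_divide smooth_family_det smooth_metric[OF M] smooth_metric[OF M0]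
        divide_pos_pos metric_det_pos[OF M] metric_det_pos[OF M0] metric_det_nz[OF M0])
  have b: "smooth_family ?P (coords c) (\<lambda>p x. b i p x)" for i
    unfolding b_def
    by (rule smooth_family_add[OF smooth_W_low[OF M M0]
          smooth_family_divide[OF smooth_pd[OF M ld] smooth_family_const]]) simp
  have "smooth_family ?P (coords c) (\<lambda>p x. Q p x)"
    unfolding Q_def g_hat_00_def
    by (intro smooth_family_ring smooth_ginv[OF M] b smooth_W_norm2[OF M M0] smooth_scal[OF M] smooth_scal[OF M0]
        smooth_cov1_W_low[OF M M0])
  then have cont: "continuous_on (?P \<times> coords c) (\<lambda>z. Q (fst z) (snd z))"
    unfolding smooth_family_def by (rule smooth_on_continuous_on)
  \<comment> \<open>The closed half-size interval makes the set of all \<open>(t,s,x)\<close> in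
    question compact while keeping it inside the open range of \<open>s\<close>.\<close>
  define K' where "K' = (\<lambda>(s, t, x). ((t, s), x)) ` ({-\<sigma>/2..\<sigma>/2} \<times> K)"
  have "compact K'" unfolding K'_def case_prod_unfold
    by (intro compact_continuous_image compact_Times continuous_intros K) auto
  moreover have "K' \<subseteq> ?P \<times> coords c" using K(2) \<sigma> by (auto simp: K'_def)
  ultimately have "bounded ((\<lambda>z. Q (fst z) (snd z)) ` K')"
    by (intro compact_imp_bounded compact_continuous_image continuous_on_subset[OF cont])
  then obtain C where C: "\<And>z. z \<in> K' \<Longrightarrow> Q (fst z) (snd z) \<le> C"
    unfolding bounded_iff by (auto simp: abs_le_iff)
  show ?thesis
  \<comment> \<open>\<open>C\<close> bounds \<open>Q\<close> weakly; the added 1 makes the Schur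
    inequality strict.\<close>
  proof (intro exI[of _ "C + 1"] exI[of _ "\<sigma> / 2"] conjI allI impI ballI, use \<sigma> in simp, clarify)
    fix N s t x assume N: "C + 1 \<le> N" and s: "\<bar>s\<bar> < \<sigma> / 2" and tx: "(t, x) \<in> K"
    have t: "t \<in> time_interval T" and x: "x \<in> coords c" using K tx by auto
    have s': "s \<in> {-\<sigma><..<\<sigma>}" using s \<sigma> by auto
    have "((t, s), x) \<in> K'"
      using s tx unfolding K'_def by (intro image_eqI[of _ _ "(s, t, x)"]) auto
    then have "Q (t, s) x < N" using C[of "((t, s), x)"] N by simp
    then have "(\<Sum>i\<in>UNIV. \<Sum>j\<in>UNIV. matrix_inv (g t s c x) $ i $ j * b i (t, s) x * b j (t, s) x)
        < g_hat T g N s c t x $ None $ None"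
      by (simp add: Q_def g_hat_None_None[OF t s' x] ginv_def)
    moreover have "positive_definite (g t s c x)"
      using metric_family_slice[OF t] s' x by (simp add: metric_family_def)
    ultimately show "positive_definite (g_hat T g N s c t x)"
      by (intro positive_definite_bordered[where b = "\<lambda>i. b i (t, s) x"]) (auto simp: g_hat_entries b_def)
  qed
qed

end

text \<open>A sufficiently large \<open>N\<close> is expressed by a threshold, chosen together with
  a range of \<open>s\<close>, for each compact piece of a chart. The variation is an entrywise
  statement in which \<open>N\<close> is an additive constant, so it is asserted for every
  \<open>N\<close>.\<close>

theorem lemma6p3:
  fixes A :: "('m::{t2_space, second_countable_topology}, 'n::finite) chart set"
    and T :: ereal and \<sigma> :: real
    and g0 h0 :: "('m, 'n) tensor2"
    and \<gamma> h :: "real \<Rightarrow> ('m, 'n) tensor2"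
    and g :: "real \<Rightarrow> real \<Rightarrow> ('m, 'n) tensor2"
  assumes "smooth_atlas A" and "0 < T" and "0 < \<sigma>"
    and "riemannian_metric A g0" and "symmetric_tensor2 A h0"
    and "ricci_flow A T \<gamma>" and "same_tensor2 A (\<gamma> 0) g0"
    and "lichnerowicz_heat_flow A T \<gamma> h" and "same_tensor2 A (h 0) h0"
    and "modified_ricci_flow_family A T \<sigma> g" and "same_tensor2 A (g 0 0) g0"
    and "\<forall>c\<in>A. \<forall>x\<in>coords c. \<forall>i j.
           ((\<lambda>s. g 0 s c x $ i $ j) has_real_derivative h0 c x $ i $ j) (at 0)"
    and "\<forall>t\<in>time_interval T. same_tensor2 A (g t 0) (\<gamma> t)"
    and "\<forall>c\<in>A. \<forall>t\<in>time_interval T. \<forall>x\<in>coords c. \<forall>i j.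
           ((\<lambda>s. g t s c x $ i $ j) has_real_derivative h t c x $ i $ j) (at 0)"
  shows "(\<forall>c\<in>A. \<forall>K. compact K \<and> K \<subseteq> time_interval T \<times> coords c \<longrightarrow>
            (\<exists>N0. \<exists>\<delta>>0. \<forall>N\<ge>N0. \<forall>s. \<bar>s\<bar> < \<delta> \<longrightarrow>
               (\<forall>(t, x)\<in>K. positive_definite (g_hat T g N s c t x))))
       \<and> (\<forall>N. \<forall>c\<in>A. \<forall>t\<in>time_interval T. \<forall>x\<in>coords c. \<forall>i j.
            ((\<lambda>s. g_hat T g N s c t x $ i $ j) has_real_derivative
               h_tilde \<gamma> h c t x $ i $ j) (at 0))"
proof (intro conjI allI ballI impI)
  fix c K assume c: "c \<in> A" and "compact K \<and> K \<subseteq> time_interval T \<times> coords c"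
  then show "\<exists>N0. \<exists>\<delta>>0. \<forall>N\<ge>N0. \<forall>s. \<bar>s\<bar> < \<delta> \<longrightarrow>
      (\<forall>(t, x)\<in>K. positive_definite (g_hat T g N s c t x))"
    by (intro g_hat_positive_definite[OF assms(1,3,10) c]) auto
next
  fix N c t x i j assume "c \<in> A" "t \<in> time_interval T" "x \<in> coords c"
  then show "((\<lambda>s. g_hat T g N s c t x $ i $ j) has_real_derivative h_tilde \<gamma> h c t x $ i $ j) (at 0)"
    using assms(13,14)
    by (intro g_hat_variation[OF assms(1,3,10)]) (auto simp: same_tensor2_def)
qed

end
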